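(* Let $k$ be a field with algebraic closure $\bar k$, $n\ge1$, $a_0,\ldots,a_{n-1}\in k$ with $a_0=0$, and $L(y)=y^{(n)}+\sum_{i=0}^{n-1}a_iy^{(i)}$. Let $\alpha_1,\ldots,\alpha_r\in\bar k$ be the distinct roots of $\lambda^n+\sum_{i=0}^{n-1}a_i\lambda^i$, with multiplicities $m_1+1,\ldots,m_r+1$ (so exactly one $\alpha_i$ equals $0$). Put $z_{j,t}=x^{[j]}e^{\alpha_tx}\in H\bar k$ for $1\le t\le r$, $0\le j\le m_t$, and $Z=(z_{0,1},\ldots,z_{m_1,1},\ldots,z_{0,r},\ldots,z_{m_r,r})$. Let $V=\{y\in Hk\mid L(y)=0\}$, let $y_1,\ldots,y_n$ be a $k$-basis of $V$, $Y=(y_1,\ldots,y_n)$, and let $T\in GL(n,\bar k)$ satisfy $YT=Z$. Let $u_t\in M(m_t+1,\bar k)$ be the nilpotent matrix with $1$'s on the superdiagonal and $0$ elsewhere ($u_t=0$ if $m_t=0$). Define $\Gamma_t=C_{\bar k}(u_t)\cap U(m_t+1,\bar k)$ if $\alpha_t=0$, and $\Gamma_t=C_{\bar k}(u_t)$ if $\alpha_t\neq0$. Then the map $\sigma\mapsto C_\sigma$, defined by $\sigma(Y)=YC_\sigma$, is a group isomorphism $$G(V|k)\;\cong\;GL(n,k)\cap T\,\{\mathrm{diag}(g_1,\ldots,g_r)\mid g_t\in\Gamma_t\}\,T^{-1},$$ where $\mathrm{diag}(g_1,\ldots,g_r)$ denotes the block-diagonal matrix with diagonal blocks $g_1,\l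dots,g_r$.
   Context: For a field $F$, $HF$ is the ring of Hurwitz series: all sequences $(a_n)_{n\in\mathbb N}$ in $F$, with termwise addition and product $(a_n)\cdot(b_n)=(c_n)$, where $c_n=\sum_{j=0}^n\binom{n}{j}a_jb_{n-j}$. It has derivation $\partial(a_0,a_1,\ldots)=(a_1,a_2,\ldots)$, written $y\mapsto y'$, with $y^{(i)}=\partial^iy$; it is applied entrywise to row vectors. $Hk\subseteq H\bar k$ naturally. Elements $c\in F$ are identified with $(c,0,0,\ldots)$. For $\beta\in F$, $e^{\beta x}=(1,\beta,\beta^2,\ldots)$. The divided powers are $x^{[i]}=(\delta^i_n)_{n\in\mathbb N}$. The entries of $Z$ form a $\bar k$-basis of the solution space of $L$ in $H\bar k$, and $Y$ is also such a basis, so $T$ exists. $G(V|k)$ denotes the group of $k$-differential automorphisms of $V$: the $k$-linear bijections $\sigma:V\to V$ with $\sigma(v')=\sigma(v)'$ for all $v\in V$ and $\sigma(c)=c$ for all $c\in k\cap V$. For $A\in M(m,F)$, $C_F(A)=\{T\in GL(m,F)\mid AT=TA\}$. $U(m,F)$ is the group of upper triangular matrices in $GL(m,F)$ with all diagonal entries $1$. *)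

theory Defs
  imports "Jordan_Normal_Form.Matrix" "HOL-Computational_Algebra.Polynomial" "HOL-Library.FuncSet"
begin

definition is_subfield :: "'K::field set \<Rightarrow> bool" where
  "is_subfield k \<longleftrightarrow> 0 \<in> k \<and> 1 \<in> k \<and>
     (\<forall>x\<in>k. \<forall>y\<in>k. x + y \<in> k \<and> x * y \<in> k) \<and>
     (\<forall>x\<in>k. - x \<in> k) \<and> (\<forall>x\<in>k. x \<noteq> 0 \<longrightarrow> inverse x \<in> k)"

definition is_algebraic_closure_of :: "'K::field set \<Rightarrow> bool" where
  "is_algebraic_closure_of k \<longleftrightarrow> is_subfield k \<and>
     (\<forall>p :: 'K poly. degree p > 0 \<longrightarrow> (\<exists>x. poly p x = 0)) \<and>
     (\<forall>x :: 'K. \<exists>p :: 'K poly. p \<noteq> 0 \<and> (\<forall>i. coeff p i \<in> k) \<and> poly p x = 0)"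

type_synonym 'a hurwitz = "nat \<Rightarrow> 'a"

definition hadd :: "'a::field hurwitz \<Rightarrow> 'a hurwitz \<Rightarrow> 'a hurwitz" where
  "hadd y z = (\<lambda>n. y n + z n)"

definition hmult :: "'a::field hurwitz \<Rightarrow> 'a hurwitz \<Rightarrow> 'a hurwitz" where
  "hmult y z = (\<lambda>n. \<Sum>j\<le>n. of_nat (n choose j) * y j * z (n - j))"

definition hconst :: "'a::field \<Rightarrow> 'a hurwitz" where
  "hconst c = (\<lambda>n. if n = 0 then c else 0)"

definition hderiv :: "'a::field hurwitz \<Rightarrow> 'a hurwitz" where
  "hderiv y = (\<lambda>n. y (Suc n))"

definition hexp :: "'a::field \<Rightarrow> 'a hurwitz" where
  "hexp \<beta> = (\<lambda>n. \<beta> ^ n)"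

definition hdivpow :: "nat \<Rightarrow> 'a::field hurwitz" where
  "hdivpow i = (\<lambda>n. if n = i then 1 else 0)"

definition hsum :: "('i \<Rightarrow> 'a::field hurwitz) \<Rightarrow> 'i set \<Rightarrow> 'a hurwitz" where
  "hsum f I = (\<lambda>q. \<Sum>i\<in>I. f i q)"

definition Lop :: "nat \<Rightarrow> (nat \<Rightarrow> 'a::field) \<Rightarrow> 'a hurwitz \<Rightarrow> 'a hurwitz" where
  "Lop n a y = hadd ((hderiv ^^ n) y) (hsum (\<lambda>i. hmult (hconst (a i)) ((hderiv ^^ i) y)) {..<n})"

definition charpoly :: "nat \<Rightarrow> (nat \<Rightarrow> 'a::field) \<Rightarrow> 'a poly" where
  "charpoly n a = monom 1 n + (\<Sum>i<n. monom (a i) i)"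

definition solV :: "'K::field set \<Rightarrow> nat \<Rightarrow> (nat \<Rightarrow> 'K) \<Rightarrow> 'K hurwitz set" where
  "solV k n a = {y. (\<forall>q. y q \<in> k) \<and> Lop n a y = (\<lambda>_. 0)}"

definition is_basis_over :: "'K::field set \<Rightarrow> 'K hurwitz set \<Rightarrow> nat \<Rightarrow> (nat \<Rightarrow> 'K hurwitz) \<Rightarrow> bool" where
  "is_basis_over k V n Y \<longleftrightarrow> (\<forall>i<n. Y i \<in> V) \<and>
     (\<forall>c. (\<forall>i<n. c i \<in> k) \<longrightarrow> hsum (\<lambda>i. hmult (hconst (c i)) (Y i)) {..<n} = (\<lambda>_. 0) \<longrightarrow> (\<forall>i<n. c i = 0)) \<and>
     (\<forall>v\<in>V. \<exists>c. (\<forall>i<n. c i \<in> k) \<and> v = hsum (\<lambda>i. hmult (hconst (c i)) (Y i)) {..<n})"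

definition diff_aut_set :: "'K::field set \<Rightarrow> 'K hurwitz set \<Rightarrow> ('K hurwitz \<Rightarrow> 'K hurwitz) set" where
  "diff_aut_set k V = {\<sigma>. \<sigma> \<in> extensional V \<and> bij_betw \<sigma> V V \<and>
     (\<forall>u\<in>V. \<forall>v\<in>V. \<sigma> (hadd u v) = hadd (\<sigma> u) (\<sigma> v)) \<and>
     (\<forall>c\<in>k. \<forall>v\<in>V. \<sigma> (hmult (hconst c) v) = hmult (hconst c) (\<sigma> v)) \<and>
     (\<forall>v\<in>V. \<sigma> (hderiv v) = hderiv (\<sigma> v)) \<and>
     (\<forall>c\<in>k. hconst c \<in> V \<longrightarrow> \<sigma> (hconst c) = hconst c)}"

definition diff_aut_group :: "'K::field set \<Rightarrow> 'K hurwitz set \<Rightarrow> ('K hurwitz \<Rightarrow> 'K hurwitz) monoid" where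
  "diff_aut_group k V = \<lparr>carrier = diff_aut_set k V, monoid.mult = (\<lambda>\<sigma> \<tau>. compose V \<sigma> \<tau>),
     one = restrict id V\<rparr>"

definition Cmat :: "'K::field set \<Rightarrow> nat \<Rightarrow> (nat \<Rightarrow> 'K hurwitz) \<Rightarrow> ('K hurwitz \<Rightarrow> 'K hurwitz) \<Rightarrow> 'K mat" where
  "Cmat k n Y \<sigma> = (THE C. C \<in> carrier_mat n n \<and> (\<forall>i<n. \<forall>j<n. C $$ (i,j) \<in> k) \<and>
      (\<forall>j<n. \<sigma> (Y j) = hsum (\<lambda>i. hmult (hconst (C $$ (i,j))) (Y i)) {..<n}))"

definition GLm :: "nat \<Rightarrow> 'a::field set \<Rightarrow> 'a mat set" where
  "GLm m S = {A. A \<in> carrier_mat m m \<and> (\<forall>i<m. \<forall>j<m. A $$ (i,j) \<in> S) \<and>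
     (\<exists>B. B \<in> carrier_mat m m \<and> (\<forall>i<m. \<forall>j<m. B $$ (i,j) \<in> S) \<and> A * B = 1\<^sub>m m \<and> B * A = 1\<^sub>m m)}"

definition inv_matrix :: "nat \<Rightarrow> 'a::field mat \<Rightarrow> 'a mat" where
  "inv_matrix m A = (THE B. B \<in> carrier_mat m m \<and> A * B = 1\<^sub>m m \<and> B * A = 1\<^sub>m m)"

definition centralizer :: "nat \<Rightarrow> 'a::field mat \<Rightarrow> 'a mat set" where
  "centralizer m A = {T \<in> GLm m UNIV. A * T = T * A}"

definition unitri :: "nat \<Rightarrow> 'a::field mat set" where
  "unitri m = {T \<in> GLm m UNIV. (\<forall>i<m. \<forall>j<m. j < i \<longrightarrow> T $$ (i,j) = 0) \<and> (\<forall>i<m. T $$ (i,i) = 1)}"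

definition nilp_u :: "nat \<Rightarrow> 'a::field mat" where
  "nilp_u m = mat m m (\<lambda>(i,j). if j = Suc i then 1 else 0)"

definition Gamma :: "nat \<Rightarrow> 'a::field \<Rightarrow> 'a mat set" where
  "Gamma m \<alpha> = (if \<alpha> = 0 then centralizer m (nilp_u m) \<inter> unitri m else centralizer m (nilp_u m))"

definition target_group :: "'K::field set \<Rightarrow> nat \<Rightarrow> 'K mat \<Rightarrow> nat \<Rightarrow> (nat \<Rightarrow> nat) \<Rightarrow> (nat \<Rightarrow> 'K) \<Rightarrow> 'K mat monoid" where
  "target_group k n T r m \<alpha> = \<lparr>carrier = GLm n k \<inter>
      {T * diag_block_mat gs * inv_matrix n T | gs. length gs = r \<and> (\<forall>t<r. gs ! t \<in> Gamma (Suc (m t)) (\<alpha> t))},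
    monoid.mult = (*), one = 1\<^sub>m n\<rparr>"

end

theory Submission
  imports Defs "Jordan_Normal_Form.Jordan_Normal_Form"
begin

text \<open>In the basis \<open>Z = Y T\<close> of exponential solutions the derivation has the block Jordan matrix \<open>J\<close>
  with blocks \<open>\<alpha>\<^sub>t + u\<^sub>t\<close>, so in the basis \<open>Y\<close> it has the matrix \<open>A = T J T\<^sup>-\<^sup>1\<close>. A matrix \<open>C\<close> over \<open>k\<close>
  describes an automorphism iff it is invertible, commutes with \<open>A\<close> and fixes the coordinate vector of \<open>1\<close>.
  For \<open>g = T\<^sup>-\<^sup>1 C T\<close> the second condition means \<open>J g = g J\<close>: as the eigenvalues are distinct,
  \<open>g\<close> is block diagonal with blocks commuting with \<open>u\<^sub>t\<close>, hence upper triangular Toeplitz. Since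
  \<open>1 = z\<^sub>0\<^sub>,\<^sub>t\<close> for the \<open>t\<close> with \<open>\<alpha>\<^sub>t = 0\<close>, the third condition says that the block of this \<open>t\<close> has first
  column \<open>e\<^sub>0\<close>, which for a Toeplitz matrix means being unitriangular.\<close>

section \<open>Block diagonal matrices\<close>

lemma diag_block_mat_square_carrier:
  assumes "\<forall>t<length As. As ! t \<in> carrier_mat (d t) (d t)"
  shows "diag_block_mat As \<in> carrier_mat (\<Sum>t<length As. d t) (\<Sum>t<length As. d t)"
proof -
  have "sum_list (map dim_row As) = (\<Sum>t<length As. d t)"
    "sum_list (map dim_col As) = (\<Sum>t<length As. d t)"
    using assms by (auto simp: sum_list_sum_nth atLeast0LessThan intro!: sum.cong)
  then show ?thesis
    by (intro carrier_matI) (simp_all add: dim_diag_block_mat)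
qed

lemma block_index_less:
  fixes d :: "nat \<Rightarrow> nat"
  assumes "t < r" "j < d t"
  shows "(\<Sum>u<t. d u) + j < (\<Sum>u<r. d u)"
proof -
  have "(\<Sum>u<t. d u) + j < (\<Sum>u<Suc t. d u)" using assms by simp
  also have "\<dots> \<le> (\<Sum>u<r. d u)" using assms by (intro sum_mono2) auto
  finally show ?thesis .
qed

text \<open>Peeling off the head of the list shifts all block sizes by one place. Hence
  \<open>d\<close>, \<open>s\<close> and \<open>t\<close> are generalised in the induction, which
  passes to the sizes \<open>d (Suc u)\<close>.\<close>

lemma diag_block_mat_index:
  assumes "\<forall>t<length As. As ! t \<in> carrier_mat (d t) (d t)"
    and "s < length As" "t < length As" "i < d s" "j < d t"
  shows "diag_block_mat As $$ ((\<Sum>u<s. d u) + i, (\<Sum>u<t. d u) + j)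
    = (if s = t then As ! t $$ (i, j) else 0)"
  using assms
proof (induction As arbitrary: d s t)
  case Nil
  then show ?case by simp
next
  case (Cons A As)
  let ?e = "\<lambda>u. d (Suc u)"
  have As: "\<forall>t<length As. As ! t \<in> carrier_mat (?e t) (?e t)"
    using Cons.prems(1) by auto
  have A: "A \<in> carrier_mat (d 0) (d 0)"
    using Cons.prems(1) by auto
  let ?N = "\<Sum>t<length As. ?e t"
  have D: "diag_block_mat As \<in> carrier_mat ?N ?N"
    by (rule diag_block_mat_square_carrier[OF As])
  have bd: "(\<Sum>u<v. ?e u) + l < ?N" if "v < length As" "l < ?e v" for v l
    using block_index_less[of v "length As" l ?e] that by simp
  show ?case
  proof (cases s; cases t)
    assume "s = 0" "t = 0"
    then show ?thesis using Cons.prems A D by (simp add: Let_def)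
  next
    fix t' assume "s = 0" "t = Suc t'"
    then show ?thesis using Cons.prems A D bd[of t' j]
      by (simp add: Let_def sum.lessThan_Suc_shift del: sum.lessThan_Suc)
  next
    fix s' assume "s = Suc s'" "t = 0"
    then show ?thesis using Cons.prems A D bd[of s' i]
      by (simp add: Let_def sum.lessThan_Suc_shift del: sum.lessThan_Suc)
  next
    fix s' t' assume st: "s = Suc s'" "t = Suc t'"
    then show ?thesis using Cons.prems A D bd[of s' i] bd[of t' j] Cons.IH[OF As, of s' t']
      by (simp add: Let_def sum.lessThan_Suc_shift del: sum.lessThan_Suc)
  qed
qed

lemma mult_diag_block_mat:
  fixes As Bs :: "'a::semiring_1 mat list"
  assumes "length As = length Bs"
    and "\<forall>t<length As. As ! t \<in> carrier_mat (d t) (d t)"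
    and "\<forall>t<length Bs. Bs ! t \<in> carrier_mat (d t) (d t)"
  shows "diag_block_mat As * diag_block_mat Bs = diag_block_mat (map2 (*) As Bs)"
  using assms
proof (induction As Bs arbitrary: d rule: list_induct2)
  case Nil
  then show ?case by auto
next
  case (Cons A As B Bs)
  let ?e = "\<lambda>u. d (Suc u)"
  have As: "\<forall>t<length As. As ! t \<in> carrier_mat (?e t) (?e t)"
    and Bs: "\<forall>t<length Bs. Bs ! t \<in> carrier_mat (?e t) (?e t)"
    using Cons.prems by auto
  have AB: "A \<in> carrier_mat (d 0) (d 0)" "B \<in> carrier_mat (d 0) (d 0)"
    using Cons.prems by auto
  let ?N = "\<Sum>t<length As. ?e t"
  have D: "diag_block_mat As \<in> carrier_mat ?N ?N" "diag_block_mat Bs \<in> carrier_mat ?N ?N"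
    using diag_block_mat_square_carrier[OF As] diag_block_mat_square_carrier[OF Bs] Cons.hyps by auto
  have D2: "diag_block_mat (map2 (*) As Bs) \<in> carrier_mat ?N ?N"
    using D Cons.IH[OF As Bs] by (metis mult_carrier_mat)
  have "four_block_mat A (0\<^sub>m (d 0) ?N) (0\<^sub>m ?N (d 0)) (diag_block_mat As) *
     four_block_mat B (0\<^sub>m (d 0) ?N) (0\<^sub>m ?N (d 0)) (diag_block_mat Bs)
     = four_block_mat (A * B) (0\<^sub>m (d 0) ?N) (0\<^sub>m ?N (d 0)) (diag_block_mat As * diag_block_mat Bs)"
    using AB D by (subst mult_four_block_mat[OF AB(1) _ _ D(1) AB(2) _ _ D(2)]) auto
  then show ?case
    using AB D D2 Cons.IH[OF As Bs] by (simp add: Let_def)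
qed

text \<open>The intervals between successive partial sums of \<open>d\<close> tile the index range.
  With \<open>block_index_unique\<close>, every matrix index is thus addressed by exactly one block
  and one position in that block.\<close>

lemma block_index_exists:
  fixes d :: "nat \<Rightarrow> nat"
  assumes "p < (\<Sum>u<r. d u)"
  obtains t j where "t < r" "j < d t" "p = (\<Sum>u<t. d u) + j"
  using assms
proof (induction r arbitrary: thesis)
  case (Suc r)
  show ?case
  proof (cases "p < (\<Sum>u<r. d u)")
    case True
    then show ?thesis using Suc.IH Suc.prems(1) by (metis less_SucI)
  next
    case False
    then show ?thesis using Suc.prems(1)[of r "p - (\<Sum>u<r. d u)"] Suc.prems(2) by auto
  qed
qed simp

lemma block_index_unique:
  fixes d :: "nat \<Rightarrow> nat"
  assumes "i < d s" "j < d t" "(\<Sum>u<s. d u) + i = (\<Sum>u<t. d u) + j"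
  shows "s = t \<and> i = j"
proof (rule linorder_cases[of s t])
  assume "s < t"
  then show ?thesis using block_index_less[of s t i d] assms by linarith
next
  assume "t < s"
  then show ?thesis using block_index_less[of t s j d] assms by linarith
qed (use assms in simp)

lemma eq_diag_block_matI:
  assumes "\<forall>t<length As. As ! t \<in> carrier_mat (d t) (d t)"
    and "M \<in> carrier_mat (\<Sum>t<length As. d t) (\<Sum>t<length As. d t)"
    and "\<And>s t i j. s < length As \<Longrightarrow> t < length As \<Longrightarrow> i < d s \<Longrightarrow> j < d t \<Longrightarrow>
      M $$ ((\<Sum>u<s. d u) + i, (\<Sum>u<t. d u) + j) = (if s = t then As ! t $$ (i, j) else 0)"
  shows "M = diag_block_mat As"
proof (rule eq_matI)
  note D = diag_block_mat_square_carrier[OF assms(1)]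
  show "dim_row M = dim_row (diag_block_mat As)" "dim_col M = dim_col (diag_block_mat As)"
    using D assms(2) by auto
  fix p q assume "p < dim_row (diag_block_mat As)" "q < dim_col (diag_block_mat As)"
  then have "p < (\<Sum>t<length As. d t)" "q < (\<Sum>t<length As. d t)" using D by auto
  then show "M $$ (p, q) = diag_block_mat As $$ (p, q)"
    by (elim block_index_exists) (simp add: assms(3) diag_block_mat_index[OF assms(1)])
qed

text \<open>Lets an equation between block diagonal matrices be split into equations between their
  blocks, provided both sides have the same block sizes.\<close>

lemma diag_block_mat_inject:
  assumes "length As = length Bs"
    and "\<forall>t<length As. As ! t \<in> carrier_mat (d t) (d t)"
    and "\<forall>t<length Bs. Bs ! t \<in> carrier_mat (d t) (d t)"
    and "diag_block_mat As = diag_block_mat Bs"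
  shows "As = Bs"
proof (rule nth_equalityI)
  fix t assume t: "t < length As"
  show "As ! t = Bs ! t"
  proof (rule eq_matI)
    have "As ! t \<in> carrier_mat (d t) (d t)" "Bs ! t \<in> carrier_mat (d t) (d t)"
      using assms t by auto
    then show "dim_row (As ! t) = dim_row (Bs ! t)" "dim_col (As ! t) = dim_col (Bs ! t)"
      by simp_all
    fix i j assume "i < dim_row (Bs ! t)" "j < dim_col (Bs ! t)"
    then have "i < d t" "j < d t" using assms t by auto
    then show "As ! t $$ (i, j) = Bs ! t $$ (i, j)"
      using diag_block_mat_index[OF assms(2) t t, of i j] diag_block_mat_index[OF assms(3), of t t i j]
        assms(1,4) t by simp
  qed
qed (rule assms(1))

lemma diag_block_mat_one:
  "diag_block_mat (map (\<lambda>t. 1\<^sub>m (d t)) [0..<r]) = 1\<^sub>m (\<Sum>t<r. d t)"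
  by (rule eq_diag_block_matI[symmetric, where d = d])
    (auto simp: block_index_less dest: block_index_unique)

section \<open>Matrices commuting with a block Jordan matrix\<close>

lemma mat_mult_index:
  assumes "A \<in> carrier_mat nr l" "B \<in> carrier_mat l nc" "i < nr" "j < nc"
  shows "(A * B) $$ (i, j) = (\<Sum>x<l. A $$ (i, x) * B $$ (x, j))"
  using assms by (simp add: scalar_prod_def atLeast0LessThan)

definition block_jordan :: "nat \<Rightarrow> (nat \<Rightarrow> nat) \<Rightarrow> (nat \<Rightarrow> 'a::field) \<Rightarrow> 'a mat" where
  "block_jordan r d \<alpha> = diag_block_mat (map (\<lambda>t. jordan_block (d t) (\<alpha> t)) [0..<r])"

lemma block_jordan_carrier [simp]:
  "block_jordan r d \<alpha> \<in> carrier_mat (\<Sum>t<r. d t) (\<Sum>t<r. d t)"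
  unfolding block_jordan_def
  using diag_block_mat_square_carrier[of "map (\<lambda>t. jordan_block (d t) (\<alpha> t)) [0..<r]" d] by simp

lemma block_jordan_index:
  assumes "s < r" "t < r" "i < d s" "j < d t"
  shows "block_jordan r d \<alpha> $$ ((\<Sum>u<s. d u) + i, (\<Sum>u<t. d u) + j)
    = (if s = t then if i = j then \<alpha> t else if Suc i = j then 1 else 0 else 0)"
  unfolding block_jordan_def
  by (subst diag_block_mat_index) (use assms in auto)

text \<open>A column of a Jordan block has only its diagonal entry and the 1 above it, and the first
  column of a block lacks the latter.\<close>

lemma sum_mult_block_jordan_col:
  assumes t: "t < r" and j: "j < d t"
  shows "(\<Sum>x<(\<Sum>u<r. d u). f x * block_jordan r d \<alpha> $$ (x, (\<Sum>u<t. d u) + j))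
    = \<alpha> t * f ((\<Sum>u<t. d u) + j) + (if 0 < j then f ((\<Sum>u<t. d u) + (j - 1)) else 0)"
proof -
  let ?o = "\<Sum>u<t. d u" and ?N = "\<Sum>u<r. d u"
  \<comment> \<open>Writing the entry as two indicators splits the sum into two one-term sums. The
    guard \<open>0 < j\<close> matters: for \<open>j = 0\<close> the truncated \<open>j - 1\<close>
    would hit the diagonal again.\<close>
  have J: "block_jordan r d \<alpha> $$ (x, ?o + j)
      = (if x = ?o + j then \<alpha> t else 0) + (if 0 < j \<and> x = ?o + (j - 1) then 1 else 0)"
    if "x < ?N" for x
    using that
  proof (elim block_index_exists)
    fix s i assume s: "s < r" "i < d s" "x = (\<Sum>u<s. d u) + i"
    show ?thesis
    proof (cases "s = t")
      case True
      then show ?thesis using s t j by (auto simp: block_jordan_index)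
    next
      case False
      then have "x \<noteq> ?o + j" "x \<noteq> ?o + (j - 1)"
        using s j block_index_unique[of i d s j t] block_index_unique[of i d s "j - 1" t]
        by (auto dest: less_imp_diff_less)
      then show ?thesis using s t j False by (auto simp: block_jordan_index)
    qed
  qed
  have lt: "?o + j < ?N" "?o + (j - 1) < ?N"
    using block_index_less[OF t, of j d] block_index_less[OF t, of "j - 1" d] j by auto
  have "(\<Sum>x<?N. f x * block_jordan r d \<alpha> $$ (x, ?o + j))
      = (\<Sum>x<?N. (if x = ?o + j then \<alpha> t * f x else 0) +
          (if x = ?o + (j - 1) then if 0 < j then f x else 0 else 0))"
    by (rule sum.cong[OF refl]) (simp add: J distrib_left distrib_right if_distrib cong: if_cong)
  also have "\<dots> = \<alpha> t * f (?o + j) + (if 0 < j then f (?o + (j - 1)) else 0)"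
    using lt by (simp add: sum.distrib)
  finally show ?thesis .
qed

lemma sum_mult_block_jordan_row:
  assumes t: "t < r" and j: "j < d t"
  shows "(\<Sum>x<(\<Sum>u<r. d u). block_jordan r d \<alpha> $$ ((\<Sum>u<t. d u) + j, x) * f x)
    = \<alpha> t * f ((\<Sum>u<t. d u) + j) + (if Suc j < d t then f ((\<Sum>u<t. d u) + Suc j) else 0)"
proof -
  let ?o = "\<Sum>u<t. d u" and ?N = "\<Sum>u<r. d u"
  \<comment> \<open>The guard \<open>Suc j < d t\<close> keeps the superdiagonal 1 from running into
    the next block.\<close>
  have J: "block_jordan r d \<alpha> $$ (?o + j, x)
      = (if x = ?o + j then \<alpha> t else 0) + (if x = ?o + Suc j then if Suc j < d t then 1 else 0 else 0)"
    if "x < ?N" for x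
    using that
  proof (elim block_index_exists)
    fix s i assume s: "s < r" "i < d s" "x = (\<Sum>u<s. d u) + i"
    show ?thesis
    proof (cases "s = t")
      case True
      then show ?thesis using s t j by (auto simp: block_jordan_index)
    next
      case False
      then have "x \<noteq> ?o + j" "Suc j < d t \<Longrightarrow> x \<noteq> ?o + Suc j"
        using s j block_index_unique[of i d s j t] block_index_unique[of i d s "Suc j" t] by auto
      then show ?thesis using s t j False by (auto simp: block_jordan_index)
    qed
  qed
  have lt: "?o + j < ?N" "Suc j < d t \<Longrightarrow> ?o + Suc j < ?N"
    using block_index_less[OF t, of j d] block_index_less[OF t, of "Suc j" d] j by auto
  have "(\<Sum>x<?N. block_jordan r d \<alpha> $$ (?o + j, x) * f x)
      = (\<Sum>x<?N. (if x = ?o + j then \<alpha> t * f x else 0) +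
          (if x = ?o + Suc j then if Suc j < d t then f x else 0 else 0))"
    by (rule sum.cong[OF refl]) (simp add: J distrib_left distrib_right if_distrib cong: if_cong)
  also have "\<dots> = \<alpha> t * f (?o + j) + (if Suc j < d t then f (?o + Suc j) else 0)"
    using lt by (simp add: sum.distrib)
  finally show ?thesis .
qed

text \<open>Comparing entries of \<open>J g = g J\<close> in block \<open>(s, t)\<close> gives
  \<open>(\<alpha> s - \<alpha> t) * g(i, j) = g(i, j - 1) - g(i + 1, j)\<close>, where entries
  outside the block count as 0. Both neighbours have smaller \<open>j + (d s - i)\<close>, so
  induction from the lower left corner kills the block, as the eigenvalues differ.\<close>

lemma commute_block_jordan_off_diagonal:
  assumes inj: "inj_on \<alpha> {..<r}"
    and g: "g \<in> carrier_mat (\<Sum>t<r. d t) (\<Sum>t<r. d t)"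
    and comm: "block_jordan r d \<alpha> * g = g * block_jordan r d \<alpha>"
    and st: "s < r" "t < r" "s \<noteq> t" and ij: "i < d s" "j < d t"
  shows "g $$ ((\<Sum>u<s. d u) + i, (\<Sum>u<t. d u) + j) = 0"
  using ij
proof (induction "j + (d s - i)" arbitrary: i j rule: less_induct)
  case less
  let ?o = "\<lambda>t. \<Sum>u<t. d u" and ?N = "\<Sum>u<r. d u" and ?J = "block_jordan r d \<alpha>"
  have lt: "?o s + i < ?N" "?o t + j < ?N"
    using less.prems st by (auto intro: block_index_less)
  have "(?J * g) $$ (?o s + i, ?o t + j) = (\<Sum>x<?N. ?J $$ (?o s + i, x) * g $$ (x, ?o t + j))"
    using lt g by (intro mat_mult_index) auto
  also have "\<dots> = \<alpha> s * g $$ (?o s + i, ?o t + j)"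
    using less.hyps[of j "Suc i"] less.prems st by (subst sum_mult_block_jordan_row) auto
  finally have 1: "(?J * g) $$ (?o s + i, ?o t + j) = \<alpha> s * g $$ (?o s + i, ?o t + j)" .
  have "(g * ?J) $$ (?o s + i, ?o t + j) = (\<Sum>x<?N. g $$ (?o s + i, x) * ?J $$ (x, ?o t + j))"
    using lt g by (intro mat_mult_index) auto
  also have "\<dots> = \<alpha> t * g $$ (?o s + i, ?o t + j)"
    using less.hyps[of "j - 1" i] less.prems st by (subst sum_mult_block_jordan_col) auto
  finally have "(\<alpha> s - \<alpha> t) * g $$ (?o s + i, ?o t + j) = 0"
    using 1 comm by auto
  moreover have "\<alpha> s \<noteq> \<alpha> t" using inj st by (auto dest: inj_onD)
  ultimately show ?case by simp
qed

lemma nilp_u_carrier [simp]: "nilp_u l \<in> carrier_mat l l"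
  by (simp add: nilp_u_def)

lemma jordan_block_eq_nilp_u: "jordan_block l c = c \<cdot>\<^sub>m 1\<^sub>m l + nilp_u l"
  by (rule eq_matI) (auto simp: nilp_u_def)

text \<open>The scalar part of a Jordan block commutes with everything and cancels.\<close>

lemma jordan_block_commute_iff:
  fixes g :: "'a::field mat"
  assumes g: "g \<in> carrier_mat l l"
  shows "jordan_block l c * g = g * jordan_block l c \<longleftrightarrow> nilp_u l * g = g * nilp_u l"
proof -
  have l: "jordan_block l c * g = c \<cdot>\<^sub>m g + nilp_u l * g"
    unfolding jordan_block_eq_nilp_u using g
    by (subst add_mult_distrib_mat[where nr = l and n = l and nc = l])
      (auto simp: mult_smult_assoc_mat[where nr = l and n = l and nc = l])
  have r: "g * jordan_block l c = c \<cdot>\<^sub>m g + g * nilp_u l"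
    unfolding jordan_block_eq_nilp_u using g
    by (subst mult_add_distrib_mat[where nr = l and n = l and nc = l])
      (auto simp: mult_smult_distrib[where nr = l and n = l and nc = l])
  have c: "nilp_u l * g \<in> carrier_mat l l" "g * nilp_u l \<in> carrier_mat l l"
    using mult_carrier_mat[OF nilp_u_carrier g] mult_carrier_mat[OF g nilp_u_carrier] by auto
  show ?thesis
  proof
    assume eq: "jordan_block l c * g = g * jordan_block l c"
    show "nilp_u l * g = g * nilp_u l"
    proof (rule eq_matI)
      fix i j assume "i < dim_row (g * nilp_u l)" "j < dim_col (g * nilp_u l)"
      then have ij: "i < l" "j < l" using c by auto
      have "(c \<cdot>\<^sub>m g + nilp_u l * g) $$ (i, j) = (c \<cdot>\<^sub>m g + g * nilp_u l) $$ (i, j)"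
        using eq l r by simp
      then show "(nilp_u l * g) $$ (i, j) = (g * nilp_u l) $$ (i, j)"
        using ij c g by (simp del: index_mult_mat(1) add: carrier_matD[OF nilp_u_carrier])
    qed (use g in \<open>auto simp: carrier_matD[OF nilp_u_carrier]\<close>)
  qed (simp add: l r)
qed

text \<open>Commuting with the nilpotent Jordan block makes \<open>g\<close> constant along diagonals, so its first
  column determines all entries on and below the diagonal.\<close>

lemma commute_nilp_u_unitriangular:
  assumes g: "g \<in> carrier_mat l l" and comm: "nilp_u l * g = g * nilp_u l"
    and col: "\<And>i. i < l \<Longrightarrow> g $$ (i, 0) = (if i = 0 then 1 else 0)"
    and ij: "i < l" "j \<le> i"
  shows "g $$ (i, j) = (if i = j then 1 else 0)"
  using ij
proof (induction j arbitrary: i)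
  case 0
  then show ?case using col by auto
next
  case (Suc j)
  then obtain i' where i: "i = Suc i'" by (cases i) auto
  have ij: "i' < l" "Suc j < l" "Suc i' < l" "j < l" using Suc.prems i by auto
  have "(nilp_u l * g) $$ (i', Suc j) = (\<Sum>x<l. nilp_u l $$ (i', x) * g $$ (x, Suc j))"
    using ij g by (intro mat_mult_index[where nr = l and nc = l]) auto
  also have "\<dots> = (\<Sum>x<l. if x = Suc i' then g $$ (x, Suc j) else 0)"
    using ij by (intro sum.cong) (auto simp: nilp_u_def)
  also have "\<dots> = g $$ (Suc i', Suc j)" using ij by simp
  finally have 1: "(nilp_u l * g) $$ (i', Suc j) = g $$ (Suc i', Suc j)" .
  have "(g * nilp_u l) $$ (i', Suc j) = (\<Sum>x<l. g $$ (i', x) * nilp_u l $$ (x, Suc j))"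
    using ij g by (intro mat_mult_index[where nr = l and nc = l]) auto
  also have "\<dots> = (\<Sum>x<l. if x = j then g $$ (i', x) else 0)"
    using ij by (intro sum.cong) (auto simp: nilp_u_def)
  also have "\<dots> = g $$ (i', j)" using ij by simp
  finally have "g $$ (Suc i', Suc j) = g $$ (i', j)" using 1 comm by simp
  then show ?case using Suc.IH[of i'] Suc.prems i by simp
qed

text \<open>Once the off-diagonal blocks vanish, the commutation relation is an equation between
  block diagonal matrices and can be read block by block.\<close>

lemma commute_block_jordan_imp_diag:
  assumes inj: "inj_on \<alpha> {..<r}"
    and g: "g \<in> carrier_mat (\<Sum>t<r. d t) (\<Sum>t<r. d t)"
    and comm: "block_jordan r d \<alpha> * g = g * block_jordan r d \<alpha>"
  obtains gs where "length gs = r" "\<forall>t<r. gs ! t \<in> carrier_mat (d t) (d t)"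
    "g = diag_block_mat gs" "\<forall>t<r. nilp_u (d t) * gs ! t = gs ! t * nilp_u (d t)"
proof -
  define gs where "gs = map (\<lambda>t. mat (d t) (d t) (\<lambda>(i, j). g $$ ((\<Sum>u<t. d u) + i, (\<Sum>u<t. d u) + j))) [0..<r]"
  define Js where "Js = map (\<lambda>t. jordan_block (d t) (\<alpha> t)) [0..<r]"
  have len: "length gs = r" "length Js = r" by (simp_all add: gs_def Js_def)
  have gs: "\<forall>t<length gs. gs ! t \<in> carrier_mat (d t) (d t)"
    and Js: "\<forall>t<length Js. Js ! t \<in> carrier_mat (d t) (d t)"
    by (simp_all add: gs_def Js_def)
  have g_eq: "g = diag_block_mat gs"
    by (rule eq_diag_block_matI[OF gs])
      (use g len in \<open>auto simp: gs_def commute_block_jordan_off_diagonal[OF inj g comm]\<close>)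
  have "map2 (*) Js gs = map2 (*) gs Js"
  proof (rule diag_block_mat_inject[where d = d])
    show "diag_block_mat (map2 (*) Js gs) = diag_block_mat (map2 (*) gs Js)"
      using comm len gs Js unfolding g_eq block_jordan_def Js_def[symmetric]
      by (simp add: mult_diag_block_mat[where d = d])
  qed (use len gs Js in \<open>auto intro!: mult_carrier_mat\<close>)
  then have "\<forall>t<r. map2 (*) Js gs ! t = map2 (*) gs Js ! t" by simp
  then have "\<forall>t<r. jordan_block (d t) (\<alpha> t) * gs ! t = gs ! t * jordan_block (d t) (\<alpha> t)"
    using len by (simp add: Js_def)
  then have "\<forall>t<r. nilp_u (d t) * gs ! t = gs ! t * nilp_u (d t)"
    using gs len by (simp add: jordan_block_commute_iff)
  then show ?thesis using that gs len g_eq by auto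
qed

lemma diag_block_mat_commute_block_jordan:
  assumes len: "length gs = r" and gs: "\<forall>t<r. gs ! t \<in> carrier_mat (d t) (d t)"
    and comm: "\<forall>t<r. nilp_u (d t) * gs ! t = gs ! t * nilp_u (d t)"
  shows "block_jordan r d \<alpha> * diag_block_mat gs = diag_block_mat gs * block_jordan r d \<alpha>"
proof -
  define Js where "Js = map (\<lambda>t. jordan_block (d t) (\<alpha> t)) [0..<r]"
  have Js: "length Js = r" "\<forall>t<r. Js ! t \<in> carrier_mat (d t) (d t)" by (simp_all add: Js_def)
  have "map2 (*) Js gs = map2 (*) gs Js"
    using len gs comm by (intro nth_equalityI) (auto simp: Js_def jordan_block_commute_iff)
  then show ?thesis
    unfolding block_jordan_def Js_def[symmetric] using len gs Js
    by (simp add: mult_diag_block_mat[where d = d])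
qed

section \<open>Conjugation and inverses of matrices\<close>

lemma mult_mat_unit_vec:
  fixes A :: "'a::semiring_1 mat"
  assumes "A \<in> carrier_mat m n" "j < n"
  shows "A *\<^sub>v unit_vec n j = col A j"
  using assms by (intro eq_vecI) auto

lemma eq_mat_by_unit_vec:
  fixes A :: "'a::semiring_1 mat"
  assumes "A \<in> carrier_mat m n" "B \<in> carrier_mat m n"
    and "\<And>j. j < n \<Longrightarrow> A *\<^sub>v unit_vec n j = B *\<^sub>v unit_vec n j"
  shows "A = B"
  using assms by (intro mat_col_eqI) (auto simp: mult_mat_unit_vec)

text \<open>Base change in both directions: \<open>P = T\<close> passes from coordinates in
  \<open>Z\<close> to coordinates in \<open>Y\<close>, and \<open>P = T\<^sup>-\<^sup>1\<close>
  passes back.\<close>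

lemma conjugate_mat:
  fixes P Q :: "'a::semiring_1 mat"
  assumes P: "P \<in> carrier_mat n n" and Q: "Q \<in> carrier_mat n n" and QP: "Q * P = 1\<^sub>m n"
    and X: "X \<in> carrier_mat n n"
  shows conjugate_mat_cancel: "Q * (P * X * Q) * P = X"
    and conjugate_mat_mult: "X' \<in> carrier_mat n n \<Longrightarrow> (P * X * Q) * (P * X' * Q) = P * (X * X') * Q"
    and conjugate_mat_mult_vec: "v \<in> carrier_vec n \<Longrightarrow> (P * X * Q) *\<^sub>v (P *\<^sub>v v) = P *\<^sub>v (X *\<^sub>v v)"
proof -
  note [simp] = assoc_mult_mat[of _ n n _ n _ n] assoc_mult_mat_vec[of _ n n _ n]
    mult_carrier_mat[of _ n n _ n] mult_mat_vec_carrier[of _ n n]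
  have cancel: "Q * (P * M) = M" if "M \<in> carrier_mat n n" for M
    using assoc_mult_mat[OF Q P that] QP that by simp
  show "Q * (P * X * Q) * P = X"
    using P Q X QP cancel by simp
  show "(P * X * Q) * (P * X' * Q) = P * (X * X') * Q" if "X' \<in> carrier_mat n n"
    using P Q X that cancel by simp
  show "(P * X * Q) *\<^sub>v (P *\<^sub>v v) = P *\<^sub>v (X *\<^sub>v v)" if "v \<in> carrier_vec n"
    using P Q X that assoc_mult_mat_vec[OF Q P that] QP by simp
qed

lemma inv_matrix_eqI:
  assumes P: "P \<in> carrier_mat n n" and Q: "Q \<in> carrier_mat n n"
    and "P * Q = 1\<^sub>m n" "Q * P = 1\<^sub>m n"
  shows "inv_matrix n P = Q"
  unfolding inv_matrix_def
proof (rule the_equality)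
  fix B assume B: "B \<in> carrier_mat n n \<and> P * B = 1\<^sub>m n \<and> B * P = 1\<^sub>m n"
  then have "B = B * (P * Q)" using assms right_mult_one_mat[of B n n] by simp
  also have "\<dots> = B * P * Q" using B assoc_mult_mat[OF _ P Q, of B n] by simp
  finally show "B = Q" using B Q by simp
qed (use assms in simp)

text \<open>Multiply \<open>A * C = C * A\<close> by \<open>D\<close> on both sides. This will make
  the inverse of a block diagonal \<open>g\<close> block diagonal too.\<close>

lemma commute_inverse_mat:
  fixes A C D :: "'a::semiring_1 mat"
  assumes A: "A \<in> carrier_mat n n" and C: "C \<in> carrier_mat n n" and D: "D \<in> carrier_mat n n"
    and CD: "C * D = 1\<^sub>m n" and DC: "D * C = 1\<^sub>m n" and comm: "A * C = C * A"
  shows "A * D = D * A"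
proof -
  note [simp] = assoc_mult_mat[of _ n n _ n _ n] mult_carrier_mat[of _ n n _ n]
  have "A * D = D * (C * A) * D" using A C D DC assoc_mult_mat[OF D C A] by simp
  also have "\<dots> = D * (A * C) * D" by (simp only: comm)
  also have "\<dots> = D * A" using A C D CD by simp
  finally show ?thesis .
qed

text \<open>The product is blockwise, so \<open>hs ! t\<close> is a right inverse of
  \<open>gs ! t\<close>; for square matrices over a field it is then two-sided.\<close>

lemma diag_block_invertible:
  fixes gs hs :: "'a::field mat list"
  assumes gs: "length gs = r" "\<forall>t<r. gs ! t \<in> carrier_mat (d t) (d t)"
    and hs: "length hs = r" "\<forall>t<r. hs ! t \<in> carrier_mat (d t) (d t)"
    and gh: "diag_block_mat gs * diag_block_mat hs = 1\<^sub>m (\<Sum>t<r. d t)" and t: "t < r"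
  shows "gs ! t \<in> GLm (d t) UNIV"
proof -
  have "map2 (*) gs hs = map (\<lambda>t. 1\<^sub>m (d t)) [0..<r]"
  proof (rule diag_block_mat_inject[where d = d])
    show "diag_block_mat (map2 (*) gs hs) = diag_block_mat (map (\<lambda>t. 1\<^sub>m (d t)) [0..<r])"
      using gh gs hs by (simp add: diag_block_mat_one mult_diag_block_mat[where d = d])
  qed (use gs hs in \<open>auto intro!: mult_carrier_mat\<close>)
  then have "map2 (*) gs hs ! t = map (\<lambda>t. 1\<^sub>m (d t)) [0..<r] ! t" by simp
  then have 1: "gs ! t * hs ! t = 1\<^sub>m (d t)" using gs hs t by simp
  moreover have "hs ! t * gs ! t = 1\<^sub>m (d t)"
    using gs hs t by (auto intro: mat_mult_left_right_inverse[OF _ _ 1])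
  ultimately show ?thesis using gs hs t by (auto simp: GLm_def)
qed

section \<open>Block diagonal matrices with blocks in the groups \<open>Gamma\<close>\<close>

lemma Gamma_carrier: "g \<in> Gamma l c \<Longrightarrow> g \<in> carrier_mat l l"
  by (auto simp: Gamma_def centralizer_def GLm_def split: if_splits)

lemma Gamma_commute: "g \<in> Gamma l c \<Longrightarrow> nilp_u l * g = g * nilp_u l"
  by (auto simp: Gamma_def centralizer_def split: if_splits)

text \<open>The inverse \<open>h\<close> commutes with the Jordan matrix as well and is therefore
  block diagonal, which makes each block of \<open>g\<close> invertible. The fixed unit vector sits
  at the start of block \<open>t0\<close>, the only one with eigenvalue 0, so it prescribes the
  first column of exactly the block that has to be unitriangular.\<close>

lemma commute_block_jordan_imp_Gamma:
  fixes g h :: "'a::field mat"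
  assumes inj: "inj_on \<alpha> {..<r}"
    and N: "N = (\<Sum>t<r. d t)" and d: "\<forall>t<r. 0 < d t"
    and g: "g \<in> carrier_mat N N" and h: "h \<in> carrier_mat N N" and gh: "g * h = 1\<^sub>m N" "h * g = 1\<^sub>m N"
    and comm: "block_jordan r d \<alpha> * g = g * block_jordan r d \<alpha>"
    and t0: "t0 < r" "\<alpha> t0 = 0"
    and fixed: "g *\<^sub>v unit_vec N (\<Sum>u<t0. d u) = unit_vec N (\<Sum>u<t0. d u)"
  obtains gs where "length gs = r" "\<forall>t<r. gs ! t \<in> Gamma (d t) (\<alpha> t)" "g = diag_block_mat gs"
proof -
  have comm_h: "block_jordan r d \<alpha> * h = h * block_jordan r d \<alpha>"
    using commute_inverse_mat[OF _ g h gh comm] N by simp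
  obtain gs where gs: "length gs = r" "\<forall>t<r. gs ! t \<in> carrier_mat (d t) (d t)"
      "g = diag_block_mat gs" "\<forall>t<r. nilp_u (d t) * gs ! t = gs ! t * nilp_u (d t)"
    using commute_block_jordan_imp_diag[OF inj g[unfolded N] comm] by metis
  obtain hs where hs: "length hs = r" "\<forall>t<r. hs ! t \<in> carrier_mat (d t) (d t)"
      "h = diag_block_mat hs"
    using commute_block_jordan_imp_diag[OF inj h[unfolded N] comm_h] by metis
  have "gs ! t \<in> Gamma (d t) (\<alpha> t)" if t: "t < r" for t
  proof -
    have GL: "gs ! t \<in> GLm (d t) UNIV"
      using diag_block_invertible[OF gs(1,2) hs(1,2) _ t] gh gs(3) hs(3) N by simp
    then have cent: "gs ! t \<in> centralizer (d t) (nilp_u (d t))"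
      using gs(4) t by (simp add: centralizer_def)
    have "gs ! t \<in> unitri (d t)" if "\<alpha> t = 0"
    proof -
      have "t = t0" using inj_onD[OF inj, of t t0] t t0 that by simp
      have col0: "gs ! t $$ (i, 0) = (if i = 0 then 1 else 0)" if i: "i < d t" for i
      proof -
        let ?o = "\<Sum>u<t. d u"
        have lt: "?o + i < N" "?o < N"
          using block_index_less[OF t, of i d] block_index_less[OF t, of 0 d] i d t N by auto
        have "gs ! t $$ (i, 0) = g $$ (?o + i, ?o)"
          using diag_block_mat_index[of gs d t t i 0] gs t i by simp
        also have "\<dots> = (g *\<^sub>v unit_vec N ?o) $ (?o + i)"
          using g lt by (simp add: mult_mat_unit_vec)
        also have "\<dots> = unit_vec N ?o $ (?o + i)" using fixed \<open>t = t0\<close> by simp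
        also have "\<dots> = (if i = 0 then 1 else 0)" using lt by simp
        finally show ?thesis .
      qed
      have "gs ! t $$ (i, j) = (if i = j then 1 else 0)" if "i < d t" "j \<le> i" for i j
      proof (rule commute_nilp_u_unitriangular[OF _ _ col0 that])
        show "gs ! t \<in> carrier_mat (d t) (d t)" "nilp_u (d t) * gs ! t = gs ! t * nilp_u (d t)"
          using gs t by simp_all
      qed
      then show ?thesis using GL by (auto simp: unitri_def)
    qed
    then show ?thesis using cent by (simp add: Gamma_def)
  qed
  then show ?thesis using that gs by blast
qed

text \<open>The column at the start of block \<open>t0\<close> is zero outside this block, and
  inside it is the first column of a unitriangular matrix.\<close>

lemma diag_Gamma_fixes_unit_vec:
  fixes gs :: "'a::field mat list"
  assumes gs: "length gs = r" "\<forall>t<r. gs ! t \<in> Gamma (d t) (\<alpha> t)"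
    and N: "N = (\<Sum>t<r. d t)" and d: "\<forall>t<r. 0 < d t" and t0: "t0 < r" "\<alpha> t0 = 0"
  shows "diag_block_mat gs *\<^sub>v unit_vec N (\<Sum>u<t0. d u) = unit_vec N (\<Sum>u<t0. d u)"
proof -
  let ?o = "\<Sum>u<t0. d u"
  have c: "\<forall>t<length gs. gs ! t \<in> carrier_mat (d t) (d t)" using gs Gamma_carrier by auto
  have D: "diag_block_mat gs \<in> carrier_mat N N"
    using diag_block_mat_square_carrier[OF c] gs N by simp
  have o: "?o < N" using block_index_less[of t0 r 0 d] d t0 N by auto
  have u: "gs ! t0 \<in> unitri (d t0)" using gs t0 by (auto simp: Gamma_def)
  have "col (diag_block_mat gs) ?o = unit_vec N ?o"
  proof (rule eq_vecI)
    fix x assume "x < dim_vec (unit_vec N ?o)"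
    then have x: "x < N" by simp
    then obtain s i where s: "s < r" "i < d s" "x = (\<Sum>u<s. d u) + i"
      using N by (auto elim: block_index_exists)
    have "col (diag_block_mat gs) ?o $ x = (if s = t0 then gs ! t0 $$ (i, 0) else 0)"
      using diag_block_mat_index[OF c, of s t0 i 0] s gs t0 d D x o by simp
    also have "\<dots> = (if s = t0 \<and> i = 0 then 1 else 0)"
      using u s d t0 by (auto simp: unitri_def)
    also have "\<dots> = unit_vec N ?o $ x"
      using block_index_unique[of i d s 0 t0] s d t0 x o by auto
    finally show "col (diag_block_mat gs) ?o $ x = unit_vec N ?o $ x" .
  qed (use D in simp)
  then show ?thesis using D o by (simp add: mult_mat_unit_vec)
qed

section \<open>Automorphisms of the solution space as matrices\<close>

lemma hmult_hconst: "hmult (hconst c) y = (\<lambda>q. c * y q)"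
proof
  fix q
  have "hmult (hconst c) y q = (\<Sum>j\<le>q. if j = 0 then c * y q else 0)"
    unfolding hmult_def hconst_def by (rule sum.cong) auto
  then show "hmult (hconst c) y q = c * y q" by simp
qed

lemma funpow_hderiv: "(hderiv ^^ i) y q = y (q + i)"
  by (induction i arbitrary: q) (simp_all add: hderiv_def)

lemma Lop_apply: "Lop n a y q = y (q + n) + (\<Sum>i<n. a i * y (q + i))"
  by (simp add: Lop_def hadd_def hsum_def hmult_hconst funpow_hderiv)

lemma hmult_hdivpow_hexp: "hmult (hdivpow j) (hexp \<beta>) q = of_nat (q choose j) * \<beta> ^ (q - j)"
proof -
  have "hmult (hdivpow j) (hexp \<beta>) q
      = (\<Sum>i\<le>q. if i = j then of_nat (q choose j) * \<beta> ^ (q - j) else 0)"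
    unfolding hmult_def hdivpow_def hexp_def by (rule sum.cong) auto
  then show ?thesis by (auto simp: binomial_eq_0)
qed

text \<open>Pascal's rule for the binomial coefficients. For fixed \<beta> it says that the
  derivation acts on these series, ordered by \<open>j\<close>, through a Jordan block with
  eigenvalue \<beta>.\<close>

lemma hderiv_hmult_hdivpow_hexp:
  "hderiv (hmult (hdivpow j) (hexp \<beta>)) q = \<beta> * hmult (hdivpow j) (hexp \<beta>) q
    + (if 0 < j then hmult (hdivpow (j - 1)) (hexp \<beta>) q else 0)"
proof (cases j)
  case 0
  then show ?thesis by (simp add: hderiv_def hmult_hdivpow_hexp)
next
  case (Suc i)
  \<comment> \<open>If \<open>q < Suc i\<close>, both truncated exponents are 0, but the binomial
    coefficient vanishes.\<close>
  have "of_nat (q choose Suc i) * \<beta> ^ (q - i) = \<beta> * (of_nat (q choose Suc i) * \<beta> ^ (q - Suc i))"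
  proof (cases "Suc i \<le> q")
    case True
    then have "q - i = Suc (q - Suc i)" by simp
    then show ?thesis by simp
  qed (simp add: binomial_eq_0)
  then show ?thesis using Suc by (simp add: hderiv_def hmult_hdivpow_hexp algebra_simps)
qed

text \<open>The product of the row \<open>Y\<close> with a column of coordinates. Coordinates are a
  \<open>vec\<close> so that matrices act on them, and they may lie in the whole field because
  \<open>T\<close> does not have entries in \<open>k\<close>.\<close>

definition hlin :: "nat \<Rightarrow> (nat \<Rightarrow> 'a::field hurwitz) \<Rightarrow> 'a vec \<Rightarrow> 'a hurwitz" where
  "hlin n Y v = (\<lambda>q. \<Sum>i<n. v $ i * Y i q)"

lemma hsum_eq_hlin: "hsum (\<lambda>i. hmult (hconst (c i)) (Y i)) {..<n} = hlin n Y (vec n c)"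
  by (simp add: hsum_def hmult_hconst hlin_def)

text \<open>Associativity \<open>Y (C v) = (Y C) v\<close>, by exchanging two finite sums.\<close>

lemma hlin_mult_mat_vec:
  assumes "C \<in> carrier_mat n n" "v \<in> carrier_vec n"
  shows "hlin n Y (C *\<^sub>v v) = hlin n (\<lambda>j. hlin n Y (col C j)) v"
proof
  fix q
  have "hlin n Y (C *\<^sub>v v) q = (\<Sum>i<n. \<Sum>j<n. C $$ (i, j) * v $ j * Y i q)"
    using assms by (simp add: hlin_def scalar_prod_def atLeast0LessThan sum_distrib_right)
  also have "\<dots> = (\<Sum>j<n. \<Sum>i<n. C $$ (i, j) * v $ j * Y i q)"
    by (rule sum.swap)
  also have "\<dots> = hlin n (\<lambda>j. hlin n Y (col C j)) v q"
    using assms by (simp add: hlin_def sum_distrib_left mult_ac)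
  finally show "hlin n Y (C *\<^sub>v v) q = hlin n (\<lambda>j. hlin n Y (col C j)) v q" .
qed

lemma hderiv_hlin: "hderiv (hlin n Y v) = hlin n (\<lambda>i. hderiv (Y i)) v"
  by (simp add: hderiv_def hlin_def)

lemma hlin_cong: "(\<And>i. i < n \<Longrightarrow> Y i = Z i) \<Longrightarrow> hlin n Y v = hlin n Z v"
  by (simp add: hlin_def)

lemma hlin_add:
  assumes "v \<in> carrier_vec n" "w \<in> carrier_vec n"
  shows "hlin n Y (v + w) = hadd (hlin n Y v) (hlin n Y w)"
  using assms by (simp add: hlin_def hadd_def distrib_right sum.distrib)

lemma hlin_smult:
  assumes "v \<in> carrier_vec n"
  shows "hlin n Y (c \<cdot>\<^sub>v v) = hmult (hconst c) (hlin n Y v)"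
  using assms by (simp add: hlin_def hmult_hconst sum_distrib_left mult_ac)

lemma hlin_unit:
  assumes "j < n"
  shows "hlin n Y (unit_vec n j) = Y j"
proof
  fix q
  have "hlin n Y (unit_vec n j) q = (\<Sum>i<n. if i = j then Y j q else 0)"
    unfolding hlin_def using assms by (intro sum.cong) auto
  then show "hlin n Y (unit_vec n j) q = Y j q" using assms by simp
qed

text \<open>\<open>L(y) = 0\<close> expresses each entry from position \<open>n\<close> on by the
  \<open>n\<close> entries before it, so the first \<open>n\<close> entries \<open>b\<close> can be
  chosen freely.\<close>

function recurrence_solution :: "nat \<Rightarrow> (nat \<Rightarrow> 'a::field) \<Rightarrow> (nat \<Rightarrow> 'a) \<Rightarrow> nat \<Rightarrow> 'a" where
  "recurrence_solution n a b q =
    (if q < n then b q else - (\<Sum>i<n. a i * recurrence_solution n a b (q - n + i)))"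
  by pat_completeness auto
termination by (relation "measure (\<lambda>(n, a, b, q). q)") auto

text \<open>The unconditional recursion equation would loop as a rewrite rule.\<close>

declare recurrence_solution.simps [simp del]

section \<open>The solution space in coordinates\<close>

locale hurwitz_basis =
  fixes k :: "'K::field set" and n :: nat and a :: "nat \<Rightarrow> 'K" and Y :: "nat \<Rightarrow> 'K hurwitz"
  assumes subfield: "is_subfield k"
    and coeffs: "\<forall>i<n. a i \<in> k"
    and basis: "is_basis_over k (solV k n a) n Y"
begin

abbreviation V :: "'K hurwitz set" where "V \<equiv> solV k n a"

lemma k_closed [simp]:
  "0 \<in> k" "1 \<in> k" "x \<in> k \<Longrightarrow> y \<in> k \<Longrightarrow> x + y \<in> k" "x \<in> k \<Longrightarrow> y \<in> k \<Longrightarrow> x * y \<in> k" "x \<in> k \<Longrightarrow> - x \<in> k"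
  using subfield by (simp_all add: is_subfield_def)

lemma k_sum: "(\<And>i. i \<in> I \<Longrightarrow> f i \<in> k) \<Longrightarrow> sum f I \<in> k"
  by (induction I rule: infinite_finite_induct) auto

definition kvec :: "'K vec set" where
  "kvec = {v \<in> carrier_vec n. \<forall>i<n. v $ i \<in> k}"

definition kmat :: "'K mat set" where
  "kmat = {C \<in> carrier_mat n n. \<forall>i<n. \<forall>j<n. C $$ (i, j) \<in> k}"

lemma kmatD [simp]: "C \<in> kmat \<Longrightarrow> C \<in> carrier_mat n n"
  by (simp add: kmat_def)

lemma kvecD [simp]: "v \<in> kvec \<Longrightarrow> v \<in> carrier_vec n"
  by (simp add: kvec_def)

lemma kmat_mult_vec_carrier [simp]: "C \<in> kmat \<Longrightarrow> v \<in> carrier_vec n \<Longrightarrow> C *\<^sub>v v \<in> carrier_vec n"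
  by (rule mult_mat_vec_carrier[OF kmatD])

lemma kvec_unit [simp]: "unit_vec n j \<in> kvec"
  by (auto simp: kvec_def unit_vec_def simp del: kvecD)

lemma kvec_smult: "c \<in> k \<Longrightarrow> v \<in> kvec \<Longrightarrow> c \<cdot>\<^sub>v v \<in> kvec"
  by (auto simp: kvec_def simp del: kvecD)

lemma kvec_add: "v \<in> kvec \<Longrightarrow> w \<in> kvec \<Longrightarrow> v + w \<in> kvec"
  by (auto simp: kvec_def simp del: kvecD)

lemma kvec_mult_mat: "C \<in> kmat \<Longrightarrow> v \<in> kvec \<Longrightarrow> C *\<^sub>v v \<in> kvec"
  by (auto simp: kvec_def kmat_def scalar_prod_def simp del: kvecD kmatD intro!: k_sum)

text \<open>Since its coefficients are constants, \<open>L\<close> commutes with the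
  derivation.\<close>

lemma V_hderiv: "v \<in> V \<Longrightarrow> hderiv v \<in> V"
proof -
  assume v: "v \<in> V"
  have "Lop n a (hderiv v) q = Lop n a v (Suc q)" for q
    by (simp add: Lop_apply hderiv_def)
  then show ?thesis using v by (auto simp: solV_def hderiv_def)
qed

lemma V_Y: "i < n \<Longrightarrow> Y i \<in> V"
  using basis by (simp add: is_basis_over_def)

lemma V_hlin: 
  assumes "v \<in> kvec"
  shows "hlin n Y v \<in> V"
proof -
  have Yk: "Y i q \<in> k" and Y0: "Y i (q + n) + (\<Sum>j<n. a j * Y i (q + j)) = 0" if "i < n" for i q
    using V_Y[OF that] by (auto simp: solV_def fun_eq_iff Lop_apply)
  have "Lop n a (hlin n Y v) q = 0" for q
  proof -
    have "(\<Sum>j<n. a j * (\<Sum>i<n. v $ i * Y i (q + j))) = (\<Sum>j<n. \<Sum>i<n. v $ i * (a j * Y i (q + j)))"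
      by (simp add: sum_distrib_left mult_ac)
    also have "\<dots> = (\<Sum>i<n. v $ i * (\<Sum>j<n. a j * Y i (q + j)))"
      by (subst sum.swap) (simp add: sum_distrib_left)
    finally have "Lop n a (hlin n Y v) q = (\<Sum>i<n. v $ i * (Y i (q + n) + (\<Sum>j<n. a j * Y i (q + j))))"
      by (simp add: Lop_apply hlin_def distrib_left sum.distrib)
    also have "\<dots> = 0" using Y0 by simp
    finally show ?thesis .
  qed
  moreover have "hlin n Y v q \<in> k" for q
    unfolding hlin_def using assms Yk
    by (intro k_sum) (auto simp: kvec_def simp del: kvecD)
  ultimately show ?thesis by (auto simp: solV_def)
qed

lemma V_coords:
  assumes "v \<in> V"
  obtains c where "c \<in> kvec" "v = hlin n Y c"
proof -
  obtain c where "\<forall>i<n. c i \<in> k" "v = hsum (\<lambda>i. hmult (hconst (c i)) (Y i)) {..<n}"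
    using basis assms unfolding is_basis_over_def by blast
  then show ?thesis using that[of "vec n c"] by (simp add: hsum_eq_hlin kvec_def del: kvecD)
qed

lemma V_initial_values:
  assumes b: "\<And>q. b q \<in> k"
  obtains v where "v \<in> V" "\<And>q. q < n \<Longrightarrow> v q = b q"
proof
  let ?v = "recurrence_solution n a b"
  show "?v q = b q" if "q < n" for q using that by (subst recurrence_solution.simps) simp
  have "?v q \<in> k" for q
  proof (induction q rule: less_induct)
    case (less q)
    have "(\<Sum>i<n. a i * ?v (q - n + i)) \<in> k" if "\<not> q < n"
      using that less coeffs by (intro k_sum) auto
    then show ?case using b by (subst recurrence_solution.simps) auto
  qed
  moreover have "Lop n a ?v q = 0" for q
    unfolding Lop_apply by (subst recurrence_solution.simps[of _ _ _ "q + n"]) simp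
  ultimately show "?v \<in> V" by (auto simp: solV_def)
qed

text \<open>Independence over all of \<open>'K\<close>, not just over \<open>k\<close>: since every vector of initial values in
  \<open>k\<close> is attained in \<open>V\<close>, the matrix of initial values of the basis is invertible.\<close>

lemma hlin_inject:
  assumes v: "v \<in> carrier_vec n" and w: "w \<in> carrier_vec n" and eq: "hlin n Y v = hlin n Y w"
  shows "v = w"
proof -
  define W where "W = mat n n (\<lambda>(q, i). Y i q)"
  have W: "W \<in> carrier_mat n n" by (simp add: W_def)
  have Wv: "W *\<^sub>v u = vec n (hlin n Y u)" if "u \<in> carrier_vec n" for u
    using that by (intro eq_vecI) (auto simp: W_def hlin_def scalar_prod_def atLeast0LessThan mult_ac)
  have "\<exists>c\<in>carrier_vec n. W *\<^sub>v c = unit_vec n j" if "j < n" for j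
  proof -
    obtain u where u: "u \<in> V" "\<And>q. q < n \<Longrightarrow> u q = (if q = j then 1 else 0)"
      using V_initial_values[of "\<lambda>q. if q = j then 1 else 0"] by (metis k_closed(1,2))
    obtain c where c: "c \<in> kvec" "u = hlin n Y c" using V_coords[OF u(1)] .
    then have "W *\<^sub>v c = unit_vec n j"
      using u that by (subst Wv) (auto simp: unit_vec_def)
    then show ?thesis using c by auto
  qed
  then obtain c where c: "\<And>j. j < n \<Longrightarrow> c j \<in> carrier_vec n \<and> W *\<^sub>v c j = unit_vec n j"
    by metis
  define B where "B = mat n n (\<lambda>(i, j). c j $ i)"
  have B: "B \<in> carrier_mat n n" by (simp add: B_def)
  have "W * B = 1\<^sub>m n"
  proof (rule eq_mat_by_unit_vec[where n = n])
    fix j assume j: "j < n"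
    have "col B j = c j" using j c[OF j] by (intro eq_vecI) (auto simp: B_def)
    then show "W * B *\<^sub>v unit_vec n j = 1\<^sub>m n *\<^sub>v unit_vec n j"
      using W B j c[OF j] by (simp add: assoc_mult_mat_vec[OF W B] mult_mat_unit_vec)
  qed (use W B in auto)
  then have BW: "B * W = 1\<^sub>m n" by (rule mat_mult_left_right_inverse[OF W B])
  have "W *\<^sub>v v = W *\<^sub>v w" using v w eq by (simp add: Wv)
  then have "B *\<^sub>v (W *\<^sub>v v) = B *\<^sub>v (W *\<^sub>v w)" by simp
  then show ?thesis using BW B W v w by (simp flip: assoc_mult_mat_vec)
qed

text \<open>A solution over \<open>k\<close> has some coordinates in \<open>k\<close>, and by
  \<open>hlin_inject\<close> no others in the larger field. This brings computations with
  \<open>T\<close> back to \<open>k\<close>.\<close>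

lemma hlin_in_V_iff:
  assumes "v \<in> carrier_vec n"
  shows "hlin n Y v \<in> V \<longleftrightarrow> v \<in> kvec"
  using assms V_coords V_hlin hlin_inject kvecD by metis

section \<open>Automorphisms and their matrices\<close>

lemma aut_zero:
  assumes "\<sigma> \<in> diff_aut_set k V"
  shows "\<sigma> (\<lambda>_. 0) = (\<lambda>_. 0)"
proof -
  have "0 \<in> k" by simp
  moreover have "(\<lambda>_. 0) \<in> V"
    by (auto simp: solV_def Lop_apply)
  ultimately have "\<sigma> (hmult (hconst 0) (\<lambda>_. 0)) = hmult (hconst 0) (\<sigma> (\<lambda>_. 0))"
    using assms unfolding diff_aut_set_def by blast
  then show ?thesis by (simp add: hmult_hconst)
qed

lemma aut_hlin:
  assumes \<sigma>: "\<sigma> \<in> diff_aut_set k V" and v: "v \<in> kvec"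
  shows "\<sigma> (hlin n Y v) = hlin n (\<lambda>i. \<sigma> (Y i)) v"
proof -
  \<comment> \<open>Additivity of \<sigma> is binary and holds only on \<open>V\<close>, so the
    induction on partial sums also has to carry their membership in \<open>V\<close>.\<close>
  have part: "(\<lambda>q. \<Sum>i<l. v $ i * Y i q) \<in> V \<and>
      \<sigma> (\<lambda>q. \<Sum>i<l. v $ i * Y i q) = (\<lambda>q. \<Sum>i<l. v $ i * \<sigma> (Y i) q)" if "l \<le> n" for l
    using that
  proof (induction l)
    case 0
    then show ?case
      using aut_zero[OF \<sigma>] by (auto simp: solV_def Lop_apply)
  next
    case (Suc l)
    \<comment> \<open>Padding the coordinates with zeros turns a partial sum into a full linear
      combination, to which \<open>V_hlin\<close> applies.\<close>
    let ?w = "vec n (\<lambda>i. if i < Suc l then v $ i else 0)"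
    have "?w \<in> kvec" using v by (auto simp: kvec_def simp del: kvecD)
    moreover have "hlin n Y ?w = (\<lambda>q. \<Sum>i<Suc l. v $ i * Y i q)"
      unfolding hlin_def by (intro ext sum.mono_neutral_cong_right) (use Suc.prems in auto)
    ultimately have 1: "(\<lambda>q. \<Sum>i<Suc l. v $ i * Y i q) \<in> V" using V_hlin by metis
    have vk: "v $ l \<in> k" and l: "l < n" using v Suc.prems by (auto simp: kvec_def simp del: kvecD)
    have "hlin n Y (v $ l \<cdot>\<^sub>v unit_vec n l) \<in> V" using vk by (intro V_hlin kvec_smult) auto
    then have 2: "hmult (hconst (v $ l)) (Y l) \<in> V" using l by (simp add: hlin_smult hlin_unit)
    have "\<sigma> (\<lambda>q. \<Sum>i<Suc l. v $ i * Y i q)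
        = \<sigma> (hadd (\<lambda>q. \<Sum>i<l. v $ i * Y i q) (hmult (hconst (v $ l)) (Y l)))"
      by (simp add: hadd_def hmult_hconst)
    also have "\<dots> = hadd (\<sigma> (\<lambda>q. \<Sum>i<l. v $ i * Y i q)) (\<sigma> (hmult (hconst (v $ l)) (Y l)))"
      using \<sigma> 2 Suc unfolding diff_aut_set_def by simp
    also have "\<sigma> (hmult (hconst (v $ l)) (Y l)) = hmult (hconst (v $ l)) (\<sigma> (Y l))"
      using \<sigma> vk V_Y[OF l] unfolding diff_aut_set_def by blast
    finally show ?case using 1 Suc by (simp add: hadd_def hmult_hconst)
  qed
  then show ?thesis unfolding hlin_def by blast
qed

text \<open>The description defining \<open>Cmat\<close> denotes because coordinates are unique, by
  \<open>hlin_inject\<close> applied to each column.\<close>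

lemma Cmat_eqI:
  assumes C: "C \<in> kmat" and eq: "\<And>j. j < n \<Longrightarrow> \<sigma> (Y j) = hlin n Y (col C j)"
  shows "Cmat k n Y \<sigma> = C"
  unfolding Cmat_def
proof (rule the_equality)
  have "vec n (\<lambda>i. C $$ (i, j)) = col C j" if "j < n" for j
    using C that by (intro eq_vecI) (auto simp: kmat_def simp del: kmatD)
  then show "C \<in> carrier_mat n n \<and> (\<forall>i<n. \<forall>j<n. C $$ (i, j) \<in> k) \<and>
      (\<forall>j<n. \<sigma> (Y j) = hsum (\<lambda>i. hmult (hconst (C $$ (i, j))) (Y i)) {..<n})"
    using C eq by (simp add: hsum_eq_hlin kmat_def del: kmatD)
next
  fix D assume D: "D \<in> carrier_mat n n \<and> (\<forall>i<n. \<forall>j<n. D $$ (i, j) \<in> k) \<and>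
      (\<forall>j<n. \<sigma> (Y j) = hsum (\<lambda>i. hmult (hconst (D $$ (i, j))) (Y i)) {..<n})"
  show "D = C"
  proof (rule eq_matI)
    fix i j assume "i < dim_row C" "j < dim_col C"
    then have ij: "i < n" "j < n" using kmatD[OF C] by auto
    have "hlin n Y (vec n (\<lambda>i. D $$ (i, j))) = hlin n Y (col C j)"
      using D eq[OF ij(2)] ij by (simp add: hsum_eq_hlin)
    then have "vec n (\<lambda>i. D $$ (i, j)) = col C j"
      using kmatD[OF C] by (intro hlin_inject) auto
    then have "vec n (\<lambda>i. D $$ (i, j)) $ i = col C j $ i" by simp
    then show "D $$ (i, j) = C $$ (i, j)" using ij kmatD[OF C] by simp
  qed (use D kmatD[OF C] in auto)
qed

lemma coords_matrix:
  assumes "\<And>j. j < n \<Longrightarrow> f j \<in> V"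
  obtains C where "C \<in> kmat" "\<And>j. j < n \<Longrightarrow> f j = hlin n Y (col C j)"
proof -
  have "\<exists>c\<in>kvec. f j = hlin n Y c" if "j < n" for j
    using V_coords[OF assms[OF that]] by metis
  then obtain c where c: "\<And>j. j < n \<Longrightarrow> c j \<in> kvec \<and> f j = hlin n Y (c j)" by metis
  let ?C = "mat n n (\<lambda>(i, j). c j $ i)"
  have "col ?C j = c j" if "j < n" for j
    using c[OF that] that by (intro eq_vecI) (auto simp: kvec_def simp del: kvecD)
  moreover have "?C \<in> kmat" using c by (auto simp: kmat_def kvec_def simp del: kvecD kmatD)
  ultimately show ?thesis using that[of ?C] c by simp
qed

lemma aut_in_V: "\<sigma> \<in> diff_aut_set k V \<Longrightarrow> v \<in> V \<Longrightarrow> \<sigma> v \<in> V"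
  unfolding diff_aut_set_def by (auto dest: bij_betwE)

lemma Cmat_aut:
  assumes \<sigma>: "\<sigma> \<in> diff_aut_set k V"
  shows Cmat_in_kmat: "Cmat k n Y \<sigma> \<in> kmat"
    and aut_eq_Cmat: "v \<in> kvec \<Longrightarrow> \<sigma> (hlin n Y v) = hlin n Y (Cmat k n Y \<sigma> *\<^sub>v v)"
proof -
  obtain C where C: "C \<in> kmat" "\<And>j. j < n \<Longrightarrow> \<sigma> (Y j) = hlin n Y (col C j)"
    using coords_matrix[of "\<lambda>j. \<sigma> (Y j)"] aut_in_V[OF \<sigma> V_Y] by metis
  have eq: "Cmat k n Y \<sigma> = C" by (rule Cmat_eqI[OF C])
  then show "Cmat k n Y \<sigma> \<in> kmat" using C by simp
  assume v: "v \<in> kvec"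
  have "\<sigma> (hlin n Y v) = hlin n (\<lambda>j. \<sigma> (Y j)) v" by (rule aut_hlin[OF \<sigma> v])
  also have "\<dots> = hlin n (\<lambda>j. hlin n Y (col C j)) v" by (rule hlin_cong[OF C(2)])
  also have "\<dots> = hlin n Y (C *\<^sub>v v)" using C v by (simp add: hlin_mult_mat_vec)
  finally show "\<sigma> (hlin n Y v) = hlin n Y (Cmat k n Y \<sigma> *\<^sub>v v)" using eq by simp
qed

text \<open>With matrices \<open>C\<close> of \<sigma> and \<open>D\<close> of \<tau>, \<sigma> is
  linear over the entries of \<open>D\<close>, so it sends \<open>Y D\<close> to
  \<open>(Y C) D = Y (C D)\<close>; the order of the factors is preserved.\<close>

lemma Cmat_compose:
  assumes \<sigma>: "\<sigma> \<in> diff_aut_set k V" and \<tau>: "\<tau> \<in> diff_aut_set k V"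
  shows "Cmat k n Y (compose V \<sigma> \<tau>) = Cmat k n Y \<sigma> * Cmat k n Y \<tau>"
proof (rule Cmat_eqI)
  let ?C = "Cmat k n Y \<sigma>" and ?D = "Cmat k n Y \<tau>"
  have CD: "?C \<in> kmat" "?D \<in> kmat" using Cmat_in_kmat \<sigma> \<tau> by auto
  then show "?C * ?D \<in> kmat"
      by (auto simp: kmat_def mat_mult_index[where l = n and nr = n and nc = n]
        simp del: index_mult_mat(1) kmatD intro!: k_sum)
  fix j assume j: "j < n"
  have "\<tau> (Y j) = hlin n Y (?D *\<^sub>v unit_vec n j)"
    using aut_eq_Cmat[OF \<tau>, of "unit_vec n j"] j by (simp add: hlin_unit)
  moreover have "?D *\<^sub>v unit_vec n j \<in> kvec" using CD by (auto intro: kvec_mult_mat)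
  ultimately have "compose V \<sigma> \<tau> (Y j) = hlin n Y (?C *\<^sub>v (?D *\<^sub>v unit_vec n j))"
    using aut_eq_Cmat[OF \<sigma>] V_Y[OF j] by (simp add: compose_def)
  also have "?C *\<^sub>v (?D *\<^sub>v unit_vec n j) = ?C * ?D *\<^sub>v unit_vec n j"
    using CD by (intro assoc_mult_mat_vec[symmetric, of _ n n _ n]) auto
  also have "\<dots> = col (?C * ?D) j"
    by (rule mult_mat_unit_vec[OF mult_carrier_mat[OF kmatD[OF CD(1)] kmatD[OF CD(2)]] j])
  finally show "compose V \<sigma> \<tau> (Y j) = hlin n Y (col (?C * ?D) j)" .
qed

lemma inj_on_Cmat: "inj_on (Cmat k n Y) (diff_aut_set k V)"
proof (rule inj_onI)
  fix \<sigma> \<tau> assume \<sigma>: "\<sigma> \<in> diff_aut_set k V" and \<tau>: "\<tau> \<in> diff_aut_set k V"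
    and eq: "Cmat k n Y \<sigma> = Cmat k n Y \<tau>"
  show "\<sigma> = \<tau>"
  proof (rule extensionalityI[where A = V])
    fix v assume "v \<in> V"
    then obtain c where "c \<in> kvec" "v = hlin n Y c" by (rule V_coords)
    then show "\<sigma> v = \<tau> v" using aut_eq_Cmat[OF \<sigma>] aut_eq_Cmat[OF \<tau>] eq by simp
  qed (use \<sigma> \<tau> in \<open>auto simp: diff_aut_set_def\<close>)
qed

lemma Cmat_in_GLm:
  assumes \<sigma>: "\<sigma> \<in> diff_aut_set k V"
  shows "Cmat k n Y \<sigma> \<in> GLm n k"
proof -
  let ?C = "Cmat k n Y \<sigma>"
  have C: "?C \<in> kmat" by (rule Cmat_in_kmat[OF \<sigma>])
  have bij: "bij_betw \<sigma> V V" using \<sigma> by (simp add: diff_aut_set_def)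
  \<comment> \<open>The matrix of the inverse map. Its entries lie in \<open>k\<close> because
    \<sigma> permutes \<open>V\<close>, so the inverse of \<open>?C\<close> is found over
    \<open>k\<close> itself.\<close>
  obtain D where D: "D \<in> kmat" "\<And>j. j < n \<Longrightarrow> inv_into V \<sigma> (Y j) = hlin n Y (col D j)"
    using coords_matrix[of "\<lambda>j. inv_into V \<sigma> (Y j)"] V_Y bij_betw_inv_into[OF bij]
    by (metis bij_betwE)
  have "?C * D = 1\<^sub>m n"
  proof (rule eq_mat_by_unit_vec[where n = n])
    fix j assume j: "j < n"
    have d: "D *\<^sub>v unit_vec n j \<in> kvec" using D by (simp add: kvec_mult_mat)
    have "hlin n Y (unit_vec n j) = \<sigma> (inv_into V \<sigma> (Y j))"
      using bij V_Y[OF j] j by (simp add: hlin_unit bij_betw_inv_into_right)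
    also have "\<dots> = \<sigma> (hlin n Y (D *\<^sub>v unit_vec n j))"
      using D j mult_mat_unit_vec[OF kmatD[OF D(1)] j] by simp
    also have "\<dots> = hlin n Y (?C *\<^sub>v (D *\<^sub>v unit_vec n j))"
      by (rule aut_eq_Cmat[OF \<sigma> d])
    finally have "unit_vec n j = ?C *\<^sub>v (D *\<^sub>v unit_vec n j)"
      using C d by (intro hlin_inject) auto
    then show "?C * D *\<^sub>v unit_vec n j = 1\<^sub>m n *\<^sub>v unit_vec n j"
      using C D assoc_mult_mat_vec[OF kmatD[OF C] kmatD[OF D(1)], of "unit_vec n j"] by simp
  qed (use mult_carrier_mat[OF kmatD[OF C] kmatD[OF D(1)]] in auto)
  moreover from this have "D * ?C = 1\<^sub>m n"
    by (rule mat_mult_left_right_inverse[OF kmatD[OF C] kmatD[OF D(1)]])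
  ultimately show ?thesis using C D unfolding GLm_def kmat_def by blast
qed

lemma GLm_imp_kmat: "C \<in> GLm n k \<Longrightarrow> C \<in> kmat"
  by (auto simp: GLm_def kmat_def simp del: kmatD)

text \<open>\<open>A\<close> is the matrix of the derivation and \<open>w\<close> the coordinate vector of \<open>1\<close> in the basis \<open>Y\<close>.\<close>

lemma Cmat_image:
  assumes A: "A \<in> carrier_mat n n"
    and deriv: "\<And>v. v \<in> carrier_vec n \<Longrightarrow> hderiv (hlin n Y v) = hlin n Y (A *\<^sub>v v)"
    and w: "w \<in> carrier_vec n" "hlin n Y w = hconst 1" and one_V: "hconst 1 \<in> V"
  shows "Cmat k n Y ` diff_aut_set k V = {C \<in> GLm n k. A * C = C * A \<and> C *\<^sub>v w = w}"
proof (intro equalityI subsetI)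
  have wk: "w \<in> kvec" using w one_V hlin_in_V_iff by metis
  \<comment> \<open>\<open>A\<close> is only given over the large field; closure of \<open>V\<close>
    under the derivation makes it preserve coordinates in \<open>k\<close>.\<close>
  have Ak: "A *\<^sub>v v \<in> kvec" if "v \<in> kvec" for v
    using that V_hderiv[OF V_hlin[OF that]] deriv[of v] A hlin_in_V_iff[of "A *\<^sub>v v"]
    by (metis kvecD mult_mat_vec_carrier)
  {
    fix C assume "C \<in> Cmat k n Y ` diff_aut_set k V"
    then obtain \<sigma> where \<sigma>: "\<sigma> \<in> diff_aut_set k V" and C_eq: "C = Cmat k n Y \<sigma>" by auto
    have C: "C \<in> kmat" and \<sigma>C: "\<And>v. v \<in> kvec \<Longrightarrow> \<sigma> (hlin n Y v) = hlin n Y (C *\<^sub>v v)"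
      using Cmat_aut[OF \<sigma>] by (auto simp: C_eq)
    have "A * C = C * A"
    proof (rule eq_mat_by_unit_vec[where n = n])
      fix j assume j: "j < n"
      let ?e = "unit_vec n j :: 'K vec"
      have "hlin n Y (C *\<^sub>v (A *\<^sub>v ?e)) = \<sigma> (hderiv (hlin n Y ?e))"
        using Ak \<sigma>C deriv by simp
      also have "\<dots> = hderiv (\<sigma> (hlin n Y ?e))"
        using \<sigma> V_hlin[OF kvec_unit] unfolding diff_aut_set_def by blast
      also have "\<dots> = hlin n Y (A *\<^sub>v (C *\<^sub>v ?e))"
        using \<sigma>C deriv[of "C *\<^sub>v ?e"] C by (simp add: mult_mat_vec_carrier[OF kmatD[OF C]])
      finally have "C *\<^sub>v (A *\<^sub>v ?e) = A *\<^sub>v (C *\<^sub>v ?e)"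
        using C mult_mat_vec_carrier[OF A] by (intro hlin_inject) auto
      then show "A * C *\<^sub>v ?e = C * A *\<^sub>v ?e"
        using assoc_mult_mat_vec[OF A kmatD[OF C], of ?e] assoc_mult_mat_vec[OF kmatD[OF C] A, of ?e]
        by simp
    qed (use A C in \<open>auto intro!: mult_carrier_mat\<close>)
    moreover have "C *\<^sub>v w = w"
    proof (rule hlin_inject)
      have "1 \<in> k" by simp
      then have "\<sigma> (hconst 1) = hconst 1" using \<sigma> one_V by (simp add: diff_aut_set_def)
      then show "hlin n Y (C *\<^sub>v w) = hlin n Y w" using \<sigma>C[OF wk] w by simp
    qed (use C w in auto)
    ultimately show "C \<in> {C \<in> GLm n k. A * C = C * A \<and> C *\<^sub>v w = w}"
      using Cmat_in_GLm[OF \<sigma>] by (simp add: C_eq)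
  }
  fix C assume "C \<in> {C \<in> GLm n k. A * C = C * A \<and> C *\<^sub>v w = w}"
  then have CGL: "C \<in> GLm n k" and comm: "A * C = C * A" and Cw: "C *\<^sub>v w = w" by auto
  have C: "C \<in> kmat" by (rule GLm_imp_kmat[OF CGL])
  obtain D where D: "D \<in> kmat" "C * D = 1\<^sub>m n" "D * C = 1\<^sub>m n"
    using CGL by (auto simp: GLm_def kmat_def simp del: kmatD)
  have CD: "C *\<^sub>v (D *\<^sub>v v) = v" "D *\<^sub>v (C *\<^sub>v v) = v" if "v \<in> kvec" for v
    using that D C assoc_mult_mat_vec[OF kmatD[OF C] kmatD[OF D(1)], of v]
      assoc_mult_mat_vec[OF kmatD[OF D(1)] kmatD[OF C], of v] by simp_all
  \<comment> \<open>\<sigma> lets \<open>C\<close> act on the coordinates, which the description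
    recovers from the series. The restriction makes it extensional.\<close>
  define \<sigma> where "\<sigma> = restrict (\<lambda>v. hlin n Y (C *\<^sub>v (THE c. c \<in> kvec \<and> v = hlin n Y c))) V"
  have \<sigma>: "\<sigma> (hlin n Y v) = hlin n Y (C *\<^sub>v v)" if v: "v \<in> kvec" for v
  proof -
    have "(THE c. c \<in> kvec \<and> hlin n Y v = hlin n Y c) = v"
      using v hlin_inject by (intro the_equality) auto
    then show ?thesis using V_hlin[OF v] by (simp add: \<sigma>_def)
  qed
  have "\<sigma> \<in> diff_aut_set k V"
    unfolding diff_aut_set_def
  proof (intro CollectI conjI ballI impI)
    show "\<sigma> \<in> extensional V" by (simp add: \<sigma>_def)
    show "bij_betw \<sigma> V V"
    proof (rule bij_betw_imageI)
      show "inj_on \<sigma> V"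
      proof (rule inj_onI)
        fix u v assume "u \<in> V" "v \<in> V" and eq: "\<sigma> u = \<sigma> v"
        then obtain c d where c: "c \<in> kvec" "u = hlin n Y c" and d: "d \<in> kvec" "v = hlin n Y d"
          by (metis V_coords)
        have "C *\<^sub>v c = C *\<^sub>v d"
          using eq c d \<sigma> C by (intro hlin_inject) auto
        then show "u = v" using c d CD by metis
      qed
      show "\<sigma> ` V = V"
      proof (intro equalityI subsetI)
        fix u assume "u \<in> \<sigma> ` V"
        then show "u \<in> V" using \<sigma> V_hlin kvec_mult_mat[OF C] by (metis V_coords imageE)
      next
        fix u assume "u \<in> V"
        then obtain c where c: "c \<in> kvec" "u = hlin n Y c" by (rule V_coords)
        then have "\<sigma> (hlin n Y (D *\<^sub>v c)) = u" using \<sigma> CD kvec_mult_mat[OF D(1)] by simp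
        then show "u \<in> \<sigma> ` V" using V_hlin kvec_mult_mat[OF D(1)] c by blast
      qed
    qed
  next
    fix u v assume "u \<in> V" "v \<in> V"
    then obtain c d where c: "c \<in> kvec" "u = hlin n Y c" and d: "d \<in> kvec" "v = hlin n Y d"
      by (metis V_coords)
    have "\<sigma> (hadd u v) = hlin n Y (C *\<^sub>v (c + d))"
      using c d \<sigma>[OF kvec_add[OF c(1) d(1)]] by (simp add: hlin_add)
    also have "C *\<^sub>v (c + d) = C *\<^sub>v c + C *\<^sub>v d"
      using c d by (intro mult_add_distrib_mat_vec[OF kmatD[OF C]]) auto
    finally show "\<sigma> (hadd u v) = hadd (\<sigma> u) (\<sigma> v)"
      using c d \<sigma> kvec_mult_mat[OF C] by (simp add: hlin_add)
  next
    fix x v assume x: "x \<in> k" and "v \<in> V"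
    then obtain c where c: "c \<in> kvec" "v = hlin n Y c" by (metis V_coords)
    have "\<sigma> (hmult (hconst x) v) = hlin n Y (C *\<^sub>v (x \<cdot>\<^sub>v c))"
      using c x \<sigma>[OF kvec_smult[OF x c(1)]] by (simp add: hlin_smult)
    also have "C *\<^sub>v (x \<cdot>\<^sub>v c) = x \<cdot>\<^sub>v (C *\<^sub>v c)"
      using c by (intro mult_mat_vec[OF kmatD[OF C]]) auto
    finally show "\<sigma> (hmult (hconst x) v) = hmult (hconst x) (\<sigma> v)"
      using c \<sigma> kvec_mult_mat[OF C] by (simp add: hlin_smult)
  next
    fix v assume "v \<in> V"
    then obtain c where c: "c \<in> kvec" "v = hlin n Y c" by (metis V_coords)
    have "\<sigma> (hderiv v) = hlin n Y (C *\<^sub>v (A *\<^sub>v c))" using c deriv Ak \<sigma> by simp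
    also have "C *\<^sub>v (A *\<^sub>v c) = A *\<^sub>v (C *\<^sub>v c)"
      using assoc_mult_mat_vec[OF A kmatD[OF C], of c] assoc_mult_mat_vec[OF kmatD[OF C] A, of c]
        comm c by simp
    finally show "\<sigma> (hderiv v) = hderiv (\<sigma> v)"
      using c \<sigma> deriv kvec_mult_mat[OF C] by simp
  next
    fix x assume x: "x \<in> k"
    \<comment> \<open>Every constant is a multiple of 1, so fixing \<open>w\<close> fixes all
      constants from \<open>k\<close>.\<close>
    have x_eq: "hconst x = hlin n Y (x \<cdot>\<^sub>v w)"
      using w by (simp add: hlin_smult hmult_hconst) (simp add: hconst_def fun_eq_iff)
    have "C *\<^sub>v (x \<cdot>\<^sub>v w) = x \<cdot>\<^sub>v w"
      using mult_mat_vec[OF kmatD[OF C], of w x] w Cw by simp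
    then show "\<sigma> (hconst x) = hconst x"
      using \<sigma>[OF kvec_smult[OF x wk]] x_eq by simp
  qed
  moreover have "Cmat k n Y \<sigma> = C"
  proof (rule Cmat_eqI[OF C])
    fix j assume j: "j < n"
    show "\<sigma> (Y j) = hlin n Y (col C j)"
      using \<sigma>[OF kvec_unit, of j] j mult_mat_unit_vec[OF kmatD[OF C] j] by (simp add: hlin_unit)
  qed
  ultimately show "C \<in> Cmat k n Y ` diff_aut_set k V" by blast
qed

end

section \<open>The characteristic polynomial and the main theorem\<close>

text \<open>Splitting off one linear factor at a time shows that the multiset
  \<open>proots p\<close> has \<open>degree p\<close> elements; its size is the sum of the orders of
  the roots.\<close>

lemma sum_order_eq_degree:
  fixes p :: "'a::field poly"
  assumes closed: "\<forall>q :: 'a poly. degree q > 0 \<longrightarrow> (\<exists>x. poly q x = 0)"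
    and "p \<noteq> 0"
  shows "(\<Sum>x | poly p x = 0. order x p) = degree p"
proof -
  have "size (proots p) = degree p"
    using \<open>p \<noteq> 0\<close>
  proof (induction "degree p" arbitrary: p)
    case 0
    then show ?case using size_proots_le[of p] by simp
  next
    case (Suc l)
    then obtain x where "poly p x = 0" using closed by (metis zero_less_Suc)
    then obtain q where q: "p = [:-x, 1:] * q" by (metis dvdE poly_eq_0_iff_dvd)
    then have "q \<noteq> 0" using Suc.prems by auto
    then have "degree p = Suc (degree q)" unfolding q by (subst degree_mult_eq) auto
    then show ?case using Suc q \<open>q \<noteq> 0\<close> by (simp add: proots_mult del: mult_pCons_left)
  qed
  then show ?thesis using \<open>p \<noteq> 0\<close> by (simp add: size_multiset_overloaded_eq)
qed

lemma charpoly_degree: "degree (charpoly n a) = n"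
  and charpoly_nonzero: "charpoly n a \<noteq> 0"
proof -
  have c: "coeff (charpoly n a) i = (if i = n then 1 else if i < n then a i else 0)" for i
    by (auto simp: charpoly_def coeff_sum coeff_monom)
  show "degree (charpoly n a) = n"
    by (intro antisym degree_le le_degree) (simp_all add: c)
  show "charpoly n a \<noteq> 0" using c[of n] by auto
qed

lemma poly_charpoly_0:
  assumes "n \<ge> 1"
  shows "poly (charpoly n a) 0 = a 0"
proof -
  have "(\<Sum>i<n. a i * 0 ^ i) = (\<Sum>i<n. if i = 0 then a 0 else 0)"
    by (rule sum.cong) auto
  then show ?thesis using assms by (simp add: charpoly_def poly_monom poly_sum)
qed

theorem mainTheorem9:
  fixes k :: "'K::field set" and n r :: nat and a :: "nat \<Rightarrow> 'K"
    and \<alpha> :: "nat \<Rightarrow> 'K" and m :: "nat \<Rightarrow> nat"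
    and Y :: "nat \<Rightarrow> 'K hurwitz" and T :: "'K mat"
  assumes closure: "is_algebraic_closure_of k"
    and n: "n \<ge> 1"
    and a_k: "\<forall>i<n. a i \<in> k" and a0: "a 0 = 0"
    and roots_inj: "inj_on \<alpha> {..<r}"
    and roots: "\<alpha> ` {..<r} = {x. poly (charpoly n a) x = 0}"
    and mult: "\<forall>t<r. order (\<alpha> t) (charpoly n a) = Suc (m t)"
    and basis: "is_basis_over k (solV k n a) n Y"
    and T_GL: "T \<in> GLm n UNIV"
    and YT: "\<forall>t<r. \<forall>j\<le>m t.
         hmult (hdivpow j) (hexp (\<alpha> t))
       = hsum (\<lambda>i. hmult (hconst (T $$ (i, (\<Sum>s<t. Suc (m s)) + j))) (Y i)) {..<n}"
  shows "Cmat k n Y \<in> iso (diff_aut_group k (solV k n a)) (target_group k n T r m \<alpha>)"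
proof -
  interpret hurwitz_basis k n a Y
    using closure a_k basis by unfold_locales (auto simp: is_algebraic_closure_of_def)
  define d where "d = (\<lambda>t. Suc (m t))"
  have d_pos: "\<forall>t<r. 0 < d t" by (simp add: d_def)
  \<comment> \<open>The multiplicities add up to the degree \<open>n\<close>, so the blocks exactly
    fill the columns of \<open>T\<close>.\<close>
  have "(\<Sum>t<r. d t) = (\<Sum>t<r. order (\<alpha> t) (charpoly n a))"
    using mult by (simp add: d_def)
  also have "\<dots> = (\<Sum>x | poly (charpoly n a) x = 0. order x (charpoly n a))"
    unfolding roots[symmetric] by (simp add: sum.reindex[OF roots_inj])
  also have "\<dots> = n"
    using closure charpoly_nonzero[of n a] charpoly_degree[of n a]
    by (subst sum_order_eq_degree) (auto simp: is_algebraic_closure_of_def)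
  finally have n_eq: "n = (\<Sum>t<r. d t)" by simp
  have "0 \<in> \<alpha> ` {..<r}" using poly_charpoly_0[OF n, of a] a0 roots by simp
  then obtain t0 where t0: "t0 < r" "\<alpha> t0 = 0" by auto
  \<comment> \<open>The position in \<open>Z\<close> of the first series of block \<open>t0\<close>,
    which is the constant 1.\<close>
  define p where "p = (\<Sum>u<t0. d u)"
  have p: "p < n" using block_index_less[OF t0(1), of 0 d] d_pos t0 n_eq by (simp add: p_def)
  define J where "J = block_jordan r d \<alpha>"
  have J: "J \<in> carrier_mat n n" using n_eq by (simp add: J_def)
  obtain U where T: "T \<in> carrier_mat n n" and U: "U \<in> carrier_mat n n"
    and TU: "T * U = 1\<^sub>m n" and UT: "U * T = 1\<^sub>m n"
    using T_GL by (auto simp: GLm_def)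
  have inv: "inv_matrix n T = U" by (rule inv_matrix_eqI[OF T U TU UT])
  define Z where "Z q = hlin n Y (col T q)" for q
  have Z: "Z ((\<Sum>u<t. d u) + j) = hmult (hdivpow j) (hexp (\<alpha> t))" if "t < r" "j < d t" for t j
  proof -
    have "(\<Sum>u<t. d u) + j < n" using block_index_less[of t r j d] that n_eq by simp
    then have "vec n (\<lambda>i. T $$ (i, (\<Sum>u<t. d u) + j)) = col T ((\<Sum>u<t. d u) + j)"
      using T by (intro eq_vecI) auto
    moreover have "hmult (hdivpow j) (hexp (\<alpha> t))
        = hsum (\<lambda>i. hmult (hconst (T $$ (i, (\<Sum>u<t. d u) + j))) (Y i)) {..<n}"
      using YT that by (simp add: d_def less_Suc_eq_le)
    ultimately show ?thesis by (simp add: hsum_eq_hlin Z_def)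
  qed
  \<comment> \<open>This is \<open>Z' = Z J\<close>, column by column.\<close>
  have Z_deriv: "hderiv (Z q) = hlin n Z (col J q)" if q: "q < n" for q
  proof
    fix x
    obtain t j where t: "t < r" "j < d t" "q = (\<Sum>u<t. d u) + j"
      using q n_eq by (auto elim: block_index_exists)
    have "hlin n Z (col J q) x = (\<Sum>y<(\<Sum>u<r. d u). Z y x * block_jordan r d \<alpha> $$ (y, (\<Sum>u<t. d u) + j))"
      unfolding hlin_def n_eq[symmetric] J_def[symmetric] using J q t
      by (intro sum.cong) (auto simp: mult.commute)
    also have "\<dots> = \<alpha> t * Z q x + (if 0 < j then Z ((\<Sum>u<t. d u) + (j - 1)) x else 0)"
      using t by (subst sum_mult_block_jordan_col) auto
    also have "\<dots> = hderiv (Z q) x"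
      using t Z[of t "j - 1"] by (simp add: Z hderiv_hmult_hdivpow_hexp del: add_diff_assoc)
    finally show "hderiv (Z q) x = hlin n Z (col J q) x" by simp
  qed
  define A where "A = T * J * U"
  have A: "A \<in> carrier_mat n n" using T J U by (auto simp: A_def intro!: mult_carrier_mat)
  have deriv: "hderiv (hlin n Y v) = hlin n Y (A *\<^sub>v v)" if v: "v \<in> carrier_vec n" for v
  proof -
    \<comment> \<open>The coordinates of the same series in the basis \<open>Z\<close>, where the
      derivation acts by \<open>J\<close>.\<close>
    define u where "u = U *\<^sub>v v"
    have u: "u \<in> carrier_vec n" using U v by (simp add: u_def)
    have v_eq: "v = T *\<^sub>v u"
      using assoc_mult_mat_vec[OF T U v] TU v by (simp add: u_def)
    have "hderiv (hlin n Y v) = hlin n (\<lambda>q. hderiv (Z q)) u"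
      unfolding v_eq Z_def using T u by (simp add: hlin_mult_mat_vec hderiv_hlin)
    also have "\<dots> = hlin n (\<lambda>q. hlin n Z (col J q)) u" by (rule hlin_cong[OF Z_deriv])
    also have "\<dots> = hlin n Z (J *\<^sub>v u)" using J u by (simp add: hlin_mult_mat_vec)
    also have "\<dots> = hlin n Y (T *\<^sub>v (J *\<^sub>v u))"
      unfolding Z_def using T J u by (simp add: hlin_mult_mat_vec mult_mat_vec_carrier[OF J])
    also have "T *\<^sub>v (J *\<^sub>v u) = A *\<^sub>v v"
      unfolding A_def v_eq by (rule conjugate_mat_mult_vec[OF T U UT J u, symmetric])
    finally show ?thesis .
  qed
  let ?e = "unit_vec n p :: 'K vec"
  define w where "w = T *\<^sub>v ?e"
  have w: "w \<in> carrier_vec n" using T by (simp add: w_def)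
  have "hlin n Y w = Z (p + 0)" using T p by (simp add: w_def Z_def mult_mat_unit_vec)
  also have "\<dots> = hmult (hdivpow 0) (hexp 0)"
    unfolding p_def using Z[of t0 0] t0 by (simp add: d_def)
  also have "\<dots> = hconst 1" by (auto simp: hmult_hdivpow_hexp hconst_def power_0_left)
  finally have w_one: "hlin n Y w = hconst 1" .
  have one_V: "hconst 1 \<in> V"
  proof -
    \<comment> \<open>As \<open>n \<ge> 1\<close>, only the term with \<open>i = 0\<close> at
      \<open>q = 0\<close> could survive, and its coefficient is \<open>a 0 = 0\<close>.\<close>
    have "Lop n a (hconst 1) q = 0" for q
      using n a0 by (auto simp: Lop_apply hconst_def intro!: sum.neutral)
    then show ?thesis using subfield by (auto simp: solV_def hconst_def is_subfield_def)
  qed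
  have target: "{C \<in> GLm n k. A * C = C * A \<and> C *\<^sub>v w = w} = carrier (target_group k n T r m \<alpha>)"
  proof (intro equalityI subsetI)
    fix C assume "C \<in> {C \<in> GLm n k. A * C = C * A \<and> C *\<^sub>v w = w}"
    then have CGL: "C \<in> GLm n k" and comm: "A * C = C * A" and Cw: "C *\<^sub>v w = w" by auto
    then obtain D where C: "C \<in> carrier_mat n n" and D: "D \<in> carrier_mat n n"
      and CD: "C * D = 1\<^sub>m n" "D * C = 1\<^sub>m n" by (auto simp: GLm_def)
    \<comment> \<open>\<open>C\<close> and its inverse rewritten in the basis \<open>Z\<close>,
      where commuting with \<open>A\<close> becomes commuting with \<open>J\<close> and fixing
      \<open>w\<close> becomes fixing \<open>?e\<close>.\<close>
    define g h where "g = U * C * T" and "h = U * D * T"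
    have g: "g \<in> carrier_mat n n" and h: "h \<in> carrier_mat n n"
      using U C D T by (auto simp: g_def h_def intro!: mult_carrier_mat)
    have J_eq: "J = U * A * T" unfolding A_def by (rule conjugate_mat_cancel[OF T U UT J, symmetric])
    have C_eq: "C = T * g * U" unfolding g_def by (rule conjugate_mat_cancel[OF U T TU C, symmetric])
    have gJ: "J * g = g * J"
      unfolding J_eq g_def using conjugate_mat_mult[OF U T TU] A C comm by simp
    have gh: "g * h = 1\<^sub>m n" "h * g = 1\<^sub>m n"
      unfolding h_def g_def using conjugate_mat_mult[OF U T TU] C D CD U UT by simp_all
    have "T *\<^sub>v (g *\<^sub>v ?e) = T *\<^sub>v ?e"
      using Cw conjugate_mat_mult_vec[OF T U UT g, of ?e] by (simp add: C_eq w_def)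
    then have "U *\<^sub>v (T *\<^sub>v (g *\<^sub>v ?e)) = U *\<^sub>v (T *\<^sub>v ?e)" by simp
    then have ge: "g *\<^sub>v ?e = ?e"
      using assoc_mult_mat_vec[OF U T, of "g *\<^sub>v ?e"] assoc_mult_mat_vec[OF U T, of ?e] UT
        mult_mat_vec_carrier[OF g, of ?e] by simp
    obtain gs where "length gs = r" "\<forall>t<r. gs ! t \<in> Gamma (d t) (\<alpha> t)" "g = diag_block_mat gs"
      using commute_block_jordan_imp_Gamma[OF roots_inj n_eq d_pos g h gh
          gJ[unfolded J_def] t0 ge[unfolded p_def]] .
    then show "C \<in> carrier (target_group k n T r m \<alpha>)"
      using CGL C_eq by (auto simp: target_group_def inv d_def)
  next
    fix C assume "C \<in> carrier (target_group k n T r m \<alpha>)"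
    then obtain gs where CGL: "C \<in> GLm n k" and gs: "length gs = r"
        "\<forall>t<r. gs ! t \<in> Gamma (d t) (\<alpha> t)" and C_eq: "C = T * diag_block_mat gs * U"
      by (auto simp: target_group_def inv d_def)
    let ?g = "diag_block_mat gs"
    have c: "\<forall>t<r. gs ! t \<in> carrier_mat (d t) (d t)"
      and comm: "\<forall>t<r. nilp_u (d t) * gs ! t = gs ! t * nilp_u (d t)"
      using gs Gamma_carrier Gamma_commute by blast+
    have g: "?g \<in> carrier_mat n n"
      using diag_block_mat_square_carrier[of gs d] c gs n_eq by simp
    have "J * ?g = ?g * J"
      unfolding J_def by (rule diag_block_mat_commute_block_jordan[OF gs(1) c comm])
    then have "A * C = C * A"
      unfolding A_def C_eq using conjugate_mat_mult[OF T U UT] J g by simp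
    moreover have "C *\<^sub>v w = w"
      unfolding C_eq w_def p_def
      using diag_Gamma_fixes_unit_vec[OF gs n_eq d_pos t0] conjugate_mat_mult_vec[OF T U UT g] by simp
    ultimately show "C \<in> {C \<in> GLm n k. A * C = C * A \<and> C *\<^sub>v w = w}" using CGL by simp
  qed
  have "bij_betw (Cmat k n Y) (diff_aut_set k V) (carrier (target_group k n T r m \<alpha>))"
    using inj_on_Cmat Cmat_image[OF A deriv w w_one one_V] target by (simp add: bij_betw_def)
  then show ?thesis
    using Cmat_compose
    by (auto simp: iso_def hom_def diff_aut_group_def target_group_def dest: bij_betwE)
qed

end
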